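(* Let $\{(R_n,B_n)\}_{n=1}^\infty\subseteq\mathcal{D}_d$ be a sequence of admissible pairs in $\mathbb{R}^d$ with $\sup_{n\ge1}\|R_n\|<\infty$. Then the infinite convolution $$\mu=\delta_{R_1^{-1}B_1}*\delta_{(R_2R_1)^{-1}B_2}*\cdots*\delta_{(R_n\cdots R_1)^{-1}B_n}*\cdots$$ is a spectral measure with a spectrum contained in $\mathbb{Z}^d$.
   Context: $\mathcal{D}_d$ is the set of pairs $(R,B)$ with $R=\mathrm{diag}(m_1,\dots,m_d)$, $m_1,\dots,m_d\ge2$ integers, and $B$ a nonempty subset of $\{0,\dots,m_1-1\}\times\cdots\times\{0,\dots,m_d-1\}$. For a finite $A\subseteq\mathbb{R}^d$, $\delta_A=\frac{1}{\#A}\sum_{a\in A}\delta_a$; for a sequence in $\mathcal{D}_d$ the finite convolutions $\delta_{R_1^{-1}B_1}*\cdots*\delta_{(R_n\cdots R_1)^{-1}B_n}$ converge weakly, and $\mu$ denotes the limit. A pair $(R,B)$ ($R$ expanding integer matrix, $B\subseteq\mathbb{Z}^d$ finite) is admissible if there is a finite $L\subseteq\mathbb{Z}^d$ with $\#L=\#B$ such that $\big[\frac{1}{\sqrt{\#B}}e^{-2\pi i(R^{-1}b)\cdot\ell}\big]_{b\in B,\ell\in L}$ is unitary. A Borel probability measure is spectral if there is a countable $\Lambda\subseteq\mathbb{R}^d$ (a spectrum) with $\{e^{2\pi i\lambda\cdot x}\}_{\lambda\in\Lambda}$ an orthonormal basis of $L^2(\mu)$. $\|\cdot\|$ is the operator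 norm. *)

theory Defs
  imports "HOL-Probability.Probability"
begin

definition int_lattice :: "(real^'d) set" where
  "int_lattice = {x. \<forall>i. x $ i \<in> \<int>}"

definition diag_mat :: "('d \<Rightarrow> int) \<Rightarrow> real^'d^'d" where
  "diag_mat m = (\<chi> i j. if i = j then real_of_int (m i) else 0)"

fun mat_prod :: "(nat \<Rightarrow> real^'d^'d) \<Rightarrow> nat \<Rightarrow> real^'d^'d" where
  "mat_prod R 0 = mat 1"
| "mat_prod R (Suc n) = R (Suc n) ** mat_prod R n"

definition unitary_on :: "'a set \<Rightarrow> 'b set \<Rightarrow> ('a \<Rightarrow> 'b \<Rightarrow> complex) \<Rightarrow> bool" where
  "unitary_on B L U \<longleftrightarrow> finite B \<and> finite L \<and> card B = card L \<and>
     (\<forall>b\<in>B. \<forall>b'\<in>B. (\<Sum>l\<in>L. U b l * cnj (U b' l)) = (if b = b' then 1 else 0)) \<and>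
     (\<forall>l\<in>L. \<forall>l'\<in>L. (\<Sum>b\<in>B. cnj (U b l) * U b l') = (if l = l' then 1 else 0))"

definition admissible :: "real^'d^'d \<Rightarrow> (real^'d) set \<Rightarrow> bool" where
  "admissible R B \<longleftrightarrow> (\<exists>L. finite L \<and> L \<subseteq> int_lattice \<and> card L = card B \<and>
     unitary_on B L (\<lambda>b l. exp (- 2 * pi * \<i> * complex_of_real ((matrix_inv R *v b) \<bullet> l))
                            / complex_of_real (sqrt (real (card B)))))"

definition in_D :: "('d \<Rightarrow> int) \<Rightarrow> (real^'d) set \<Rightarrow> bool" where
  "in_D m B \<longleftrightarrow> (\<forall>i. m i \<ge> 2) \<and> B \<noteq> {} \<and>
     (\<forall>b\<in>B. \<forall>i. b $ i \<in> \<int> \<and> 0 \<le> b $ i \<and> b $ i \<le> real_of_int (m i) - 1)"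

definition delta_set :: "'a set \<Rightarrow> 'a pmf" where
  "delta_set A = pmf_of_set A"

definition conv_pmf :: "'a::ab_group_add pmf \<Rightarrow> 'a pmf \<Rightarrow> 'a pmf" where
  "conv_pmf p q = bind_pmf p (\<lambda>x. map_pmf (\<lambda>y. x + y) q)"

fun fin_conv :: "(nat \<Rightarrow> real^'d^'d) \<Rightarrow> (nat \<Rightarrow> (real^'d) set) \<Rightarrow> nat \<Rightarrow> (real^'d) pmf" where
  "fin_conv R B 0 = return_pmf 0"
| "fin_conv R B (Suc n) =
     conv_pmf (fin_conv R B n)
       (delta_set ((\<lambda>b. matrix_inv (mat_prod R (Suc n)) *v b) ` B (Suc n)))"

definition weak_conv :: "(nat \<Rightarrow> 'a::topological_space measure) \<Rightarrow> 'a measure \<Rightarrow> bool" where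
  "weak_conv M N \<longleftrightarrow> (\<forall>f :: 'a \<Rightarrow> real. continuous_on UNIV f \<and> bounded (range f) \<longrightarrow>
      (\<lambda>n. integral\<^sup>L (M n) f) \<longlonglongrightarrow> integral\<^sup>L N f)"

definition expo :: "'a::real_inner \<Rightarrow> 'a \<Rightarrow> complex" where
  "expo lam x = exp (2 * pi * \<i> * complex_of_real (lam \<bullet> x))"

definition square_integrable :: "'a measure \<Rightarrow> ('a \<Rightarrow> complex) \<Rightarrow> bool" where
  "square_integrable \<mu> f \<longleftrightarrow> f \<in> borel_measurable \<mu> \<and> integrable \<mu> (\<lambda>x. (cmod (f x))\<^sup>2)"

text \<open>{e_lam}_{lam\<in>Lam} is an orthonormal basis of L^2(\<mu>): orthonormal, and complete
  (only the zero element of L^2(\<mu>) is orthogonal to all e_lam).\<close>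
definition spectrum_of :: "'a::real_inner measure \<Rightarrow> 'a set \<Rightarrow> bool" where
  "spectrum_of \<mu> Lam \<longleftrightarrow> countable Lam \<and>
     (\<forall>lam\<in>Lam. \<forall>lam'\<in>Lam. (LINT x|\<mu>. expo lam x * cnj (expo lam' x)) = (if lam = lam' then 1 else 0)) \<and>
     (\<forall>f. square_integrable \<mu> f \<and> (\<forall>lam\<in>Lam. (LINT x|\<mu>. f x * cnj (expo lam x)) = 0)
          \<longrightarrow> (AE x in \<mu>. f x = 0))"

definition spectral :: "'a::real_inner measure \<Rightarrow> bool" where
  "spectral \<mu> \<longleftrightarrow> (\<exists>Lam. spectrum_of \<mu> Lam)"

end

theory Submission
  imports Defs
begin

text \<open>
  Write \<open>p\<^sub>n\<close> for the diagonal of \<open>R\<^sub>n \<cdots> R\<^sub>1\<close> and \<open>\<nu>\<^sub>n\<close> for the infinite convolution built from the pairs after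
  the \<open>n\<close>-th, so that the transform of \<open>\<mu>\<close> at \<open>\<xi>\<close> is the transform of the \<open>n\<close>-th finite convolution at \<open>\<xi>\<close>
  times that of \<open>\<nu>\<^sub>n\<close> at \<open>\<xi> / p\<^sub>n\<close>. Boundedness of the norms leaves only finitely many pairs.

  Every convolution over a finite alphabet lives on the unit cube and charges at most one of any two
  opposite faces: charging both would force almost all digits to be minimal and maximal at once. So it
  is carried by a set that embeds into the torus, and its transform cannot vanish on a whole
  translate of the integer lattice. By compactness of the space of digit sequences this
  becomes uniform: there are \<open>e, \<delta> > 0\<close> such that for all tails \<open>\<nu>\<^sub>n\<close> and all \<open>x\<close> some integer translate of
  \<open>x\<close> has a \<open>\<delta>\<close>-neighbourhood on which the transform of \<open>\<nu>\<^sub>n\<close> is at least \<open>e\<close> in modulus.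

  Finite convolutions have finite integer spectra, and points of such a spectrum may be translated by
  \<open>p\<^sub>n\<close> times an integer vector. Choosing these translations by the uniform lower bound gives nested
  finite spectra \<open>\<Lambda>\<^sub>j\<close> along which \<open>\<Sum>|\<mu>^(\<xi> + \<lambda>)|\<^sup>2\<close> dominates the finite-level sums up to the factor
  \<open>e\<^sup>2\<close>; dominated convergence yields Parseval's identity for their union, and hence completeness.
\<close>

subsection \<open>Uniqueness of Fourier coefficients on the unit cube\<close>

lemma expo_add: "expo (a + b) x = expo a x * expo b x"
  by (simp add: expo_def inner_add_left ring_distribs exp_add)

lemma expo_zero [simp]: "expo 0 x = 1"
  by (simp add: expo_def)

lemma expo_cis: "expo a x = cis (2 * pi * (a \<bullet> x))"
  by (simp add: expo_def cis_conv_exp mult_ac)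

lemma norm_expo [simp]: "norm (expo a x) = 1"
  by (simp add: expo_cis)

lemma cnj_expo: "cnj (expo a x) = expo (- a) x"
  by (simp add: expo_cis cis_cnj)

lemma expo_commute: "expo a x = expo x a"
  by (simp add: expo_def inner_commute)

lemma expo_diff_mult_cnj: "expo (a - b) x = expo a x * cnj (expo b x)"
  using expo_add[of a "-b" x] by (simp add: cnj_expo)

lemma continuous_on_expo [continuous_intros]: "continuous_on S (expo a)"
  unfolding expo_def by (intro continuous_intros)

lemma borel_measurable_expo [measurable]: "expo (a :: 'a :: euclidean_space) \<in> borel_measurable borel"
  by (intro borel_measurable_continuous_onI continuous_intros)

lemma int_lattice_zero [simp]: "0 \<in> int_lattice"
  by (simp add: int_lattice_def)

lemma int_lattice_add [intro]: "a \<in> int_lattice \<Longrightarrow> b \<in> int_lattice \<Longrightarrow> a + b \<in> int_lattice"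
  by (simp add: int_lattice_def)

lemma int_lattice_minus [intro]: "a \<in> int_lattice \<Longrightarrow> - a \<in> int_lattice"
  by (simp add: int_lattice_def)

lemma int_lattice_diff [intro]: "a \<in> int_lattice \<Longrightarrow> b \<in> int_lattice \<Longrightarrow> a - b \<in> int_lattice"
  by (simp add: int_lattice_def)

lemma int_lattice_axis [intro]: "axis i 1 \<in> int_lattice"
  by (simp add: int_lattice_def axis_def)

lemma expo_int_lattice:
  assumes "a \<in> int_lattice" "b \<in> int_lattice"
  shows "expo a b = 1"
proof -
  have "a \<bullet> b \<in> \<int>"
    using assms by (auto simp: inner_vec_def int_lattice_def intro!: Ints_sum Ints_mult)
  then obtain n :: int where "a \<bullet> b = n" by (auto elim: Ints_cases)
  then show ?thesis by (simp add: expo_cis cis_multiple_2pi)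
qed

text \<open>Off the closed set the distance is positive, so the factor \<open>n\<close> eventually
  cuts the function down to 0. These bounded continuous cut-offs carry identities from continuous
  functions to closed sets in \<open>annihilated_closed\<close> and
  \<open>finite_measure_eqI_continuous\<close>.\<close>

lemma infdist_tendsto_indicator:
  fixes S :: "'a::metric_space set"
  assumes S: "closed S" "S \<noteq> {}"
  shows "(\<lambda>n. max 0 (1 - real n * infdist z S)) \<longlonglongrightarrow> indicator S z"
proof (cases "z \<in> S")
  case False
  then have pos: "infdist z S > 0"
    using S by (simp add: infdist_pos_not_in_closed)
  obtain N where N: "1 / infdist z S < real N" using reals_Archimedean2 by blast
  have "max 0 (1 - real n * infdist z S) = 0" if "n \<ge> N" for n
  proof -
    have "1 / infdist z S < real n" using N that by linarith
    then show ?thesis using pos by (simp add: field_simps)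
  qed
  then have "\<forall>\<^sub>F n in sequentially. max 0 (1 - real n * infdist z S) = indicator S z"
    using False by (auto simp: eventually_sequentially)
  then show ?thesis by (rule tendsto_eventually)
qed simp

text \<open>The multiplier functions \<^term>\<open>G\<close> for which all Fourier coefficients of the complex
  measure with density \<^term>\<open>\<lambda>x. h x * G x\<close> vanish; in the proof of uniqueness this class grows from
  the constant 1 to all indicator functions of Borel sets.\<close>
definition annihilated :: "(real^'d) measure \<Rightarrow> (real^'d \<Rightarrow> complex) \<Rightarrow> (real^'d \<Rightarrow> complex) \<Rightarrow> bool" where
  "annihilated \<nu> h G \<longleftrightarrow> G \<in> borel_measurable borel \<and> (\<exists>C. \<forall>x. norm (G x) \<le> C) \<and>
     (\<forall>k\<in>int_lattice. (LINT x|\<nu>. h x * G x * expo k x) = 0)"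

context
  fixes \<nu> :: "(real^'d) measure" and h :: "real^'d \<Rightarrow> complex"
  assumes sets_nu [measurable_cong]: "sets \<nu> = sets borel"
    and h_int: "integrable \<nu> h"
begin

lemma integrable_mult_bounded:
  assumes [measurable]: "G \<in> borel_measurable borel" and "\<And>x. norm (G x) \<le> C"
  shows "integrable \<nu> (\<lambda>x. h x * G x)"
proof (rule Bochner_Integration.integrable_bound)
  show "integrable \<nu> (\<lambda>x. C *\<^sub>R h x)" using h_int by (rule integrable_scaleR_right)
  show "(\<lambda>x. h x * G x) \<in> borel_measurable \<nu>"
    using borel_measurable_integrable[OF h_int] by measurable
  show "AE x in \<nu>. norm (h x * G x) \<le> norm (C *\<^sub>R h x)"
    using assms(2) order_trans[OF norm_ge_zero assms(2)]
    by (intro AE_I2) (simp add: norm_mult mult.commute mult_right_mono)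
qed

lemma integrable_annihilated:
  assumes "annihilated \<nu> h G"
  shows "integrable \<nu> (\<lambda>x. h x * G x * expo k x)"
proof -
  obtain C where C: "\<And>x. norm (G x) \<le> C" and [measurable]: "G \<in> borel_measurable borel"
    using assms by (auto simp: annihilated_def)
  have "integrable \<nu> (\<lambda>x. h x * (G x * expo k x))"
    using C by (intro integrable_mult_bounded[where C = C]) (auto simp: norm_mult)
  then show ?thesis by (simp add: mult.assoc)
qed

lemma annihilated_add:
  assumes "annihilated \<nu> h G" "annihilated \<nu> h G'"
  shows "annihilated \<nu> h (\<lambda>x. G x + G' x)"
proof -
  obtain C C' where C: "\<And>x. norm (G x) \<le> C" "\<And>x. norm (G' x) \<le> C'"
    using assms by (auto simp: annihilated_def)
  have "norm (G x + G' x) \<le> C + C'" for x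
    using C[of x] norm_triangle_ineq[of "G x" "G' x"] by linarith
  moreover have "(LINT x|\<nu>. h x * (G x + G' x) * expo k x) = 0" if "k \<in> int_lattice" for k
    using that assms integrable_annihilated[OF assms(1), of k] integrable_annihilated[OF assms(2), of k]
    by (simp add: ring_distribs annihilated_def)
  ultimately show ?thesis
    using assms by (auto simp: annihilated_def)
qed

lemma annihilated_cmult:
  assumes "annihilated \<nu> h G"
  shows "annihilated \<nu> h (\<lambda>x. c * G x)"
proof -
  obtain C where C: "\<And>x. norm (G x) \<le> C"
    using assms by (auto simp: annihilated_def)
  have "norm (c * G x) \<le> norm c * C" for x
    using C[of x] by (simp add: norm_mult mult_left_mono)
  moreover have "(LINT x|\<nu>. h x * (c * G x) * expo k x) = 0" if "k \<in> int_lattice" for k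
  proof -
    have "(LINT x|\<nu>. h x * (c * G x) * expo k x) = (LINT x|\<nu>. c * (h x * G x * expo k x))"
      by (simp add: mult_ac)
    also have "\<dots> = c * (LINT x|\<nu>. h x * G x * expo k x)"
      by (rule integral_mult_right_zero)
    finally show ?thesis using that assms by (simp add: annihilated_def)
  qed
  ultimately show ?thesis
    using assms by (auto simp: annihilated_def)
qed

lemma annihilated_diff:
  assumes "annihilated \<nu> h G" "annihilated \<nu> h G'"
  shows "annihilated \<nu> h (\<lambda>x. G x - G' x)"
  using annihilated_add[OF assms(1) annihilated_cmult[OF assms(2), of "-1"]] by simp

lemma annihilated_expo:
  assumes "annihilated \<nu> h G" "l \<in> int_lattice"
  shows "annihilated \<nu> h (\<lambda>x. expo l x * G x)"
proof -
  have "(LINT x|\<nu>. h x * (expo l x * G x) * expo k x) = 0" if "k \<in> int_lattice" for k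
  proof -
    have "(LINT x|\<nu>. h x * (expo l x * G x) * expo k x) = (LINT x|\<nu>. h x * G x * expo (l + k) x)"
      by (simp add: expo_add mult_ac)
    then show ?thesis using assms that by (auto simp: annihilated_def)
  qed
  then show ?thesis using assms by (auto simp: annihilated_def norm_mult)
qed

text \<open>Dominated convergence with majorant \<open>C * norm (h x)\<close>. Convergence is only
  almost everywhere, so the pointwise bound on \<open>G'\<close> is a separate assumption.\<close>

lemma annihilated_limit:
  assumes G: "\<And>n. annihilated \<nu> h (G n)" and bnd: "\<And>n x. norm (G n x) \<le> C"
    and lim: "AE x in \<nu>. (\<lambda>n. G n x) \<longlonglongrightarrow> G' x"
    and [measurable]: "G' \<in> borel_measurable borel" and bnd': "\<And>x. norm (G' x) \<le> C'"
  shows "annihilated \<nu> h G'"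
proof -
  have [measurable]: "G n \<in> borel_measurable borel" for n
    using G by (auto simp: annihilated_def)
  have [measurable]: "h \<in> borel_measurable \<nu>" using h_int by auto
  have "(LINT x|\<nu>. h x * G' x * expo k x) = 0" if "k \<in> int_lattice" for k
  proof -
    have "(\<lambda>n. LINT x|\<nu>. h x * G n x * expo k x) \<longlonglongrightarrow> (LINT x|\<nu>. h x * G' x * expo k x)"
    proof (rule integral_dominated_convergence)
      show "integrable \<nu> (\<lambda>x. C * norm (h x))" using h_int by auto
      show "AE x in \<nu>. (\<lambda>n. h x * G n x * expo k x) \<longlonglongrightarrow> h x * G' x * expo k x"
        using lim by eventually_elim (intro tendsto_intros)
      show "AE x in \<nu>. norm (h x * G n x * expo k x) \<le> C * norm (h x)" for n
        using bnd by (intro AE_I2) (simp add: norm_mult mult.commute[of "norm (h _)"] mult_right_mono)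
    qed measurable
    moreover have "(LINT x|\<nu>. h x * G n x * expo k x) = 0" for n
      using G that by (simp add: annihilated_def)
    ultimately show ?thesis by (simp add: LIMSEQ_const_iff)
  qed
  then show ?thesis using bnd' by (auto simp: annihilated_def)
qed

text \<open>Evaluated at \<open>expo (axis i 1) x\<close>, a real polynomial on the complex plane is
  a trigonometric polynomial in the i-th coordinate, and the class is stable under lattice
  characters. Letting \<open>G\<close> vary in the induction reduces products to applying two
  hypotheses in turn.\<close>

lemma annihilated_polynomial:
  fixes p :: "complex \<Rightarrow> real"
  assumes "real_polynomial_function p" and "annihilated \<nu> h G"
  shows "annihilated \<nu> h (\<lambda>x. complex_of_real (p (expo (axis i 1) x)) * G x)"
  using assms
proof (induction p arbitrary: G rule: real_polynomial_function.induct)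
  case (linear f)
  let ?e = "\<lambda>x. expo (axis i 1) x"
  \<comment> \<open>Coefficients of \<open>z\<close> and \<open>cnj z\<close> when the real-linear
    \<open>f\<close> is written in terms of both.\<close>
  let ?a = "(complex_of_real (f 1) - \<i> * complex_of_real (f \<i>)) / 2"
  let ?b = "(complex_of_real (f 1) + \<i> * complex_of_real (f \<i>)) / 2"
  have f: "f z = Re z * f 1 + Im z * f \<i>" for z
  proof -
    have "z = Re z *\<^sub>R 1 + Im z *\<^sub>R \<i>" by (simp add: complex_eq_iff)
    then have "f z = f (Re z *\<^sub>R 1 + Im z *\<^sub>R \<i>)" by (rule arg_cong)
    also have "\<dots> = Re z * f 1 + Im z * f \<i>"
      using linear(1) by (simp add: bounded_linear.linear linear_add linear_scale)
    finally show ?thesis .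
  qed
  have f': "complex_of_real (f z) = ?a * z + ?b * cnj z" for z
    by (subst f) (simp add: complex_eq_iff field_simps)
  have eq: "complex_of_real (f (?e x)) * G x
      = ?a * (expo (axis i 1) x * G x) + ?b * (expo (- axis i 1) x * G x)" for x
    unfolding f'[of "?e x"] cnj_expo distrib_right mult.assoc by (rule refl)
  show ?case unfolding eq
    by (intro annihilated_add annihilated_cmult annihilated_expo int_lattice_axis int_lattice_minus linear)
next
  case (const c)
  then show ?case by (rule annihilated_cmult)
next
  case (add f g)
  then show ?case by (simp add: ring_distribs annihilated_add)
next
  case (mult f g)
  then show ?case by (simp add: mult.assoc)
qed

text \<open>Stone-Weierstrass on the unit circle, where the characters take their values; the
  approximating polynomials are uniformly bounded there.\<close>

lemma annihilated_continuous:
  fixes f :: "complex \<Rightarrow> real"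
  assumes f: "continuous_on UNIV f" and G: "annihilated \<nu> h G"
  shows "annihilated \<nu> h (\<lambda>x. complex_of_real (f (expo (axis i 1) x)) * G x)"
proof -
  let ?S = "sphere (0 :: complex) 1"
  have [measurable]: "f \<in> borel_measurable borel"
    using f by (rule borel_measurable_continuous_onI)
  have [measurable]: "G \<in> borel_measurable borel" using G by (simp add: annihilated_def)
  obtain C where C: "\<And>x. norm (G x) \<le> C" using G by (auto simp: annihilated_def)
  have C0: "0 \<le> C" using order_trans[OF norm_ge_zero C] .
  have "\<exists>p. real_polynomial_function p \<and> (\<forall>z\<in>?S. \<bar>f z - p z\<bar> < 1 / Suc n)" for n
    by (rule Stone_Weierstrass_real_polynomial_function[of ?S f "1 / Suc n"])
       (auto intro: continuous_on_subset[OF f])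
  then obtain p where p: "\<And>n. real_polynomial_function (p n)"
      and pf: "\<And>n z. z \<in> ?S \<Longrightarrow> \<bar>f z - p n z\<bar> < 1 / Suc n"
    by metis
  obtain D where D: "\<And>z. z \<in> ?S \<Longrightarrow> \<bar>f z\<bar> \<le> D"
  proof -
    have "compact (f ` ?S)"
      using f by (intro compact_continuous_image continuous_on_subset[OF f]) auto
    then obtain D where "\<forall>z\<in>?S. \<bar>f z\<bar> \<le> D"
      by (auto dest!: compact_imp_bounded simp: bounded_iff)
    then show ?thesis using that[of D] by blast
  qed
  have pD: "\<bar>p n z\<bar> \<le> D + 1" if "z \<in> ?S" for n z
  proof -
    have "1 / real (Suc n) \<le> 1" by simp
    then show ?thesis using pf[OF that, of n] D[OF that] by linarith
  qed
  show ?thesis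
  proof (rule annihilated_limit)
    show "annihilated \<nu> h (\<lambda>x. complex_of_real (p n (expo (axis i 1) x)) * G x)" for n
      by (rule annihilated_polynomial[OF p G])
    show "norm (complex_of_real (p n (expo (axis i 1) x)) * G x) \<le> (D + 1) * C" for n x
      unfolding norm_mult by (intro mult_mono) (use C pD C0 order_trans[OF abs_ge_zero pD, of 1] in auto)
    show "norm (complex_of_real (f (expo (axis i 1) x)) * G x) \<le> D * C" for x
      unfolding norm_mult by (intro mult_mono) (use C D C0 order_trans[OF abs_ge_zero D, of 1] in auto)
    have "(\<lambda>n. p n z) \<longlonglongrightarrow> f z" if "z \<in> ?S" for z
    proof (rule LIMSEQ_I)
      fix r :: real assume "0 < r"
      then obtain N where "1 / Suc N < r" using nat_approx_posE by blast
      then have "norm (p n z - f z) < r" if "n \<ge> N" for n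
      proof -
        have "1 / real (Suc n) \<le> 1 / Suc N" using that by (simp add: field_simps)
        then show ?thesis using pf[OF \<open>z \<in> ?S\<close>, of n] \<open>1 / Suc N < r\<close> by auto
      qed
      then show "\<exists>no. \<forall>n\<ge>no. norm (p n z - f z) < r" by blast
    qed
    then show "AE x in \<nu>. (\<lambda>n. complex_of_real (p n (expo (axis i 1) x)) * G x)
        \<longlonglongrightarrow> complex_of_real (f (expo (axis i 1) x)) * G x"
      by (intro AE_I2 tendsto_intros) auto
  qed measurable
qed

lemma annihilated_closed:
  assumes S: "closed S" "S \<noteq> {}" and G: "annihilated \<nu> h G"
  shows "annihilated \<nu> h (\<lambda>x. indicator S (expo (axis i 1) x) * G x)"
proof -
  let ?f = "\<lambda>n z. max 0 (1 - real n * infdist z S)"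
  have [measurable]: "G \<in> borel_measurable borel" using G by (simp add: annihilated_def)
  have [measurable]: "S \<in> sets borel" using S by simp
  obtain C where C: "\<And>x. norm (G x) \<le> C" using G by (auto simp: annihilated_def)
  have C0: "0 \<le> C" using order_trans[OF norm_ge_zero C] .
  show ?thesis
  proof (rule annihilated_limit)
    show "annihilated \<nu> h (\<lambda>x. complex_of_real (?f n (expo (axis i 1) x)) * G x)" for n
      by (rule annihilated_continuous[OF _ G]) (intro continuous_intros)
    show "norm (complex_of_real (?f n (expo (axis i 1) x)) * G x) \<le> 1 * C" for n x
      unfolding norm_mult by (intro mult_mono) (use C C0 infdist_nonneg in \<open>auto intro!: mult_nonneg_nonneg\<close>)
    show "norm (indicator S (expo (axis i 1) x) * G x) \<le> 1 * C" for x
      unfolding norm_mult by (intro mult_mono) (use C C0 in \<open>auto simp: indicator_def\<close>)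
    have "(\<lambda>n. complex_of_real (?f n z)) \<longlonglongrightarrow> indicator S z" for z
      using tendsto_of_real[OF infdist_tendsto_indicator[OF S, of z], where 'a = complex]
      by (cases "z \<in> S") simp_all
    then show "AE x in \<nu>. (\<lambda>n. complex_of_real (?f n (expo (axis i 1) x)) * G x)
        \<longlonglongrightarrow> indicator S (expo (axis i 1) x) * G x"
      by (intro AE_I2 tendsto_intros) auto
  qed measurable
qed

lemma annihilated_AE_cong:
  assumes "annihilated \<nu> h G" and "AE x in \<nu>. G x = G' x"
    and "G' \<in> borel_measurable borel" and "\<And>x. norm (G' x) \<le> C"
  shows "annihilated \<nu> h G'"
proof -
  obtain D where "\<And>x. norm (G x) \<le> D" using assms(1) by (auto simp: annihilated_def)
  then show ?thesis
    by (rule annihilated_limit[where G = "\<lambda>_. G" and C = D and C' = C, rotated]) (use assms in auto)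
qed

text \<open>On the unit interval \<open>cis (2 * pi * t)\<close> identifies only the endpoints 0 and
  1. The last disjunction keeps the interval and the coordinate away from a common endpoint, so the
  preimage of the closed arc is the interval up to a null set.\<close>

lemma annihilated_arc:
  assumes ab: "0 \<le> a" "a \<le> b" "b \<le> 1" and G: "annihilated \<nu> h G"
    and AE: "AE x in \<nu>. 0 \<le> x $ i \<and> x $ i \<le> 1 \<and> (x $ i < 1 \<and> b < 1 \<or> 0 < x $ i \<and> 0 < a)"
  shows "annihilated \<nu> h (\<lambda>x. indicator {a..b} (x $ i) * G x)"
proof -
  have [measurable]: "G \<in> borel_measurable borel" using G by (simp add: annihilated_def)
  obtain C where C: "\<And>x. norm (G x) \<le> C" using G by (auto simp: annihilated_def)
  let ?S = "(\<lambda>t. cis (2 * pi * t)) ` {a..b}"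
  have "compact ?S"
    by (intro compact_continuous_image continuous_intros) auto
  then have "closed ?S" by (rule compact_imp_closed)
  have eq: "cis (2 * pi * t) \<in> ?S \<longleftrightarrow> t \<in> {a..b}"
    if "0 \<le> t" "t \<le> 1" "t < 1 \<and> b < 1 \<or> 0 < t \<and> 0 < a" for t
  proof
    assume "cis (2 * pi * t) \<in> ?S"
    then obtain s where s: "s \<in> {a..b}" "cis (2 * pi * t) = cis (2 * pi * s)" by auto
    then obtain n :: int where "\<i> * (2 * pi * t) = \<i> * (2 * pi * s) + (of_int (2 * n) * pi) * \<i>"
      unfolding cis_conv_exp exp_eq by auto
    then have "2 * pi * t = 2 * pi * s + 2 * n * pi"
      by (simp add: complex_eq_iff)
    then have "2 * pi * (t - s - n) = 0" by (simp add: algebra_simps)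
    then have t: "t = s + n" by simp
    have "\<bar>t - s\<bar> < 1" using s that ab by auto
    then have "n = 0" using t by linarith
    then show "t \<in> {a..b}" using t s by simp
  qed auto
  show ?thesis
  proof (rule annihilated_AE_cong)
    show "annihilated \<nu> h (\<lambda>x. indicator ?S (expo (axis i 1) x) * G x)"
      using ab \<open>closed ?S\<close> G by (intro annihilated_closed) auto
    show "AE x in \<nu>. indicator ?S (expo (axis i 1) x) * G x = indicator {a..b} (x $ i) * G x"
      using AE by eventually_elim (use eq in \<open>auto simp: indicator_def expo_cis inner_axis'\<close>)
    show "norm (indicator {a..b} (x $ i) * G x) \<le> C" for x
      using C[of x] order_trans[OF norm_ge_zero C] by (auto simp: indicator_def)
  qed measurable
qed

text \<open>For \<open>0 \<le> a < 1\<close> the face without mass decides. If it is the face at 1,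
  \<open>{0..a}\<close> comes from an arc. If it is the face at 0, that arc would also catch mass at
  1, so the complement is treated instead.\<close>

lemma annihilated_coordinate:
  assumes cube: "AE x in \<nu>. 0 \<le> x $ i \<and> x $ i \<le> 1"
    and face: "(AE x in \<nu>. x $ i \<noteq> 0) \<or> (AE x in \<nu>. x $ i \<noteq> 1)"
    and G: "annihilated \<nu> h G"
  shows "annihilated \<nu> h (\<lambda>x. indicator {..a} (x $ i) * G x)"
proof -
  have [measurable]: "G \<in> borel_measurable borel" using G by (simp add: annihilated_def)
  obtain C where C: "\<And>x. norm (G x) \<le> C" using G by (auto simp: annihilated_def)
  have C0: "0 \<le> C" using order_trans[OF norm_ge_zero C] .
  have bnd: "norm (indicator S (x $ i) * G x) \<le> C" for x and S :: "real set"
    using C[of x] C0 by (auto simp: indicator_def)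
  consider "a < 0" | "a \<ge> 1" | "0 \<le> a" "a < 1" "AE x in \<nu>. x $ i \<noteq> 1"
    | "0 \<le> a" "a < 1" "AE x in \<nu>. x $ i \<noteq> 0"
    using face by linarith
  then show ?thesis
  proof cases
    case 1
    show ?thesis
    proof (rule annihilated_AE_cong)
      show "annihilated \<nu> h (\<lambda>x. 0 * G x)" using G by (rule annihilated_cmult)
      show "AE x in \<nu>. 0 * G x = indicator {..a} (x $ i) * G x"
        using cube by eventually_elim (use 1 in auto)
    qed (measurable, rule bnd)
  next
    case 2
    show ?thesis
    proof (rule annihilated_AE_cong)
      show "annihilated \<nu> h G" by fact
      show "AE x in \<nu>. G x = indicator {..a} (x $ i) * G x"
        using cube by eventually_elim (use 2 in auto)
    qed (measurable, rule bnd)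
  next
    case 3
    show ?thesis
    proof (rule annihilated_AE_cong)
      have "AE x in \<nu>. 0 \<le> x $ i \<and> x $ i \<le> 1 \<and> (x $ i < 1 \<and> a < 1 \<or> 0 < x $ i \<and> 0 < (0::real))"
        using cube 3(3) by eventually_elim (use 3 in auto)
      then show "annihilated \<nu> h (\<lambda>x. indicator {0..a} (x $ i) * G x)"
        using G 3 by (intro annihilated_arc) auto
      show "AE x in \<nu>. indicator {0..a} (x $ i) * G x = indicator {..a} (x $ i) * G x"
        using cube by eventually_elim (auto simp: indicator_def)
    qed (measurable, rule bnd)
  next
    case 4
    \<comment> \<open>Decreases from 1 to \<open>a\<close> and stays positive even for
      \<open>a = 0\<close>, so each arc \<open>{?a n..1}\<close> avoids the endpoint 0; their union
      is \<open>{a<..1}\<close>.\<close>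
    let ?a = "\<lambda>n. a + (1 - a) / Suc n"
    have a: "0 < ?a n" "?a n \<le> 1" for n
    proof -
      show "0 < ?a n" using 4 by (intro add_nonneg_pos divide_pos_pos) auto
      have "(1 - a) / Suc n \<le> 1 - a" using 4 by (simp add: field_simps mult_left_le_one_le)
      then show "?a n \<le> 1" by linarith
    qed
    have *: "annihilated \<nu> h (\<lambda>x. indicator {a<..1} (x $ i) * G x)"
    proof (rule annihilated_limit)
      have "AE x in \<nu>. 0 \<le> x $ i \<and> x $ i \<le> 1 \<and> (x $ i < 1 \<and> (1::real) < 1 \<or> 0 < x $ i \<and> 0 < ?a n)" for n
        using cube 4(3) by eventually_elim (use a in auto)
      then show "annihilated \<nu> h (\<lambda>x. indicator {?a n..1} (x $ i) * G x)" for n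
        using G a[of n] by (intro annihilated_arc) auto
      have "(\<lambda>n. indicator {?a n..1} t) \<longlonglongrightarrow> (indicator {a<..1} t :: complex)" for t
      proof (cases "a < t \<and> t \<le> 1")
        case True
        then obtain N where N: "1 / Suc N < (t - a) / (1 - a)"
          using nat_approx_posE[of "(t - a) / (1 - a)"] 4 by auto
        have "t \<in> {?a n..1}" if "n \<ge> N" for n
        proof -
          have "(1 - a) / Suc n \<le> (1 - a) / Suc N" using that 4 by (intro divide_left_mono) auto
          also have "\<dots> < t - a" using N 4 by (simp add: field_simps)
          finally show ?thesis using True by simp
        qed
        then have "\<forall>\<^sub>F n in sequentially. indicator {?a n..1} t = (indicator {a<..1} t :: complex)"
          using True by (auto simp: eventually_sequentially indicator_def)
        then show ?thesis by (rule tendsto_eventually)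
      next
        case False
        have "t \<notin> {?a n..1}" for n
        proof
          assume "t \<in> {?a n..1}"
          moreover have "0 < (1 - a) / Suc n" using 4 by simp
          ultimately show False using False by auto
        qed
        then show ?thesis using False by simp
      qed
      then show "AE x in \<nu>. (\<lambda>n. indicator {?a n..1} (x $ i) * G x)
          \<longlonglongrightarrow> indicator {a<..1} (x $ i) * G x"
        by (intro AE_I2 tendsto_intros)
    qed (rule bnd, measurable, rule bnd)
    show ?thesis
    proof (rule annihilated_AE_cong)
      show "annihilated \<nu> h (\<lambda>x. G x - indicator {a<..1} (x $ i) * G x)"
        by (intro annihilated_diff G *)
      show "AE x in \<nu>. G x - indicator {a<..1} (x $ i) * G x = indicator {..a} (x $ i) * G x"
        using cube by eventually_elim (auto simp: indicator_def)
    qed (measurable, rule bnd)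
  qed
qed

text \<open>Pi-lambda argument: the orthants \<open>{..a}\<close> generate the Borel sets and are
  closed under intersection, and their indicators are products of coordinate indicators, which are
  multiplied on one at a time.\<close>

lemma annihilated_borel:
  assumes cube: "\<And>i. AE x in \<nu>. 0 \<le> x $ i \<and> x $ i \<le> 1"
    and face: "\<And>i. (AE x in \<nu>. x $ i \<noteq> 0) \<or> (AE x in \<nu>. x $ i \<noteq> 1)"
    and one: "annihilated \<nu> h (\<lambda>_. 1)" and A: "A \<in> sets borel"
  shows "annihilated \<nu> h (indicator A)"
proof -
  have corner: "annihilated \<nu> h (indicator {..a})" for a
  proof -
    have "annihilated \<nu> h (\<lambda>x. \<Prod>i\<in>J. indicator {..a $ i} (x $ i))" if "finite J" for J
      using that
      by (induction J) (simp_all add: one annihilated_coordinate[OF cube face])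
    from this[of UNIV] have "annihilated \<nu> h (\<lambda>x. \<Prod>i\<in>UNIV. indicator {..a $ i} (x $ i))" by simp
    also have "(\<lambda>x. \<Prod>i\<in>UNIV. indicator {..a $ i} (x $ i)) = (indicator {..a} :: _ \<Rightarrow> complex)"
      by (auto simp: fun_eq_iff indicator_def less_eq_vec_def)
    finally show ?thesis .
  qed
  have "Int_stable (range (\<lambda>a::real^'d. {..a}))"
  proof -
    have "{..a} \<inter> {..b} = {..inf a b}" for a b :: "real^'d" by auto
    then show ?thesis by (auto simp: Int_stable_def)
  qed
  moreover have "range (\<lambda>a::real^'d. {..a}) \<subseteq> Pow UNIV" by simp
  moreover have A': "A \<in> sigma_sets UNIV (range (\<lambda>a::real^'d. {..a}))"
    using A by (simp add: borel_eq_atMost)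
  ultimately show ?thesis
  proof (induction rule: sigma_sets_induct_disjoint)
    case (basic A)
    then show ?case using corner by auto
  next
    case empty
    show ?case using annihilated_cmult[OF one, of 0] by (simp add: indicator_def[abs_def])
  next
    case (compl A)
    have "(indicator (UNIV - A) :: _ \<Rightarrow> complex) = (\<lambda>x. 1 - indicator A x)"
      by (auto simp: indicator_def)
    then show ?case using annihilated_diff[OF one compl(2)] by simp
  next
    case (union A)
    have bor: "A n \<in> sets borel" for n
      using union(2) by (auto simp: borel_eq_atMost)
    \<comment> \<open>Disjointness turns the partial sums into indicators, hence the bound 1
      independent of \<open>n\<close>.\<close>
    have fin: "(\<Sum>m<n. indicator (A m) x) = (indicator (\<Union>m<n. A m) x :: complex)" for n x
      using disjoint_family_on_mono[OF subset_UNIV union(1)] by (subst indicator_UN_disjoint) auto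
    show ?case
    proof (rule annihilated_limit[where C = 1 and C' = 1])
      have "annihilated \<nu> h (\<lambda>x. \<Sum>m<n. indicator (A m) x)" for n
        by (induction n) (use annihilated_cmult[OF one, of 0] union(3) in \<open>auto intro!: annihilated_add\<close>)
      then show "annihilated \<nu> h (indicator (\<Union>m<n. A m))" for n
        by (simp add: fin)
      show "AE x in \<nu>. (\<lambda>n. indicator (\<Union>m<n. A m) x) \<longlonglongrightarrow> (indicator (\<Union>m. A m) x :: complex)"
        by (intro AE_I2 LIMSEQ_indicator_UN)
      show "indicator (\<Union> (range A)) \<in> borel_measurable borel"
        using bor by measurable
    qed (auto simp: indicator_def)
  qed
qed

text \<open>A measure on the cube charging at most one of any two opposite faces is carried by a set on which
  the projection to the torus is injective, so it is determined by its integer Fourier coefficients.\<close>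
lemma fourier_uniqueness_cube:
  assumes cube: "\<And>i. AE x in \<nu>. 0 \<le> x $ i \<and> x $ i \<le> 1"
    and face: "\<And>i. (AE x in \<nu>. x $ i \<noteq> 0) \<or> (AE x in \<nu>. x $ i \<noteq> 1)"
    and fin: "finite_measure \<nu>"
    and zero: "\<And>k. k \<in> int_lattice \<Longrightarrow> (LINT x|\<nu>. h x * expo k x) = 0"
  shows "AE x in \<nu>. h x = 0"
proof -
  interpret finite_measure \<nu> by (rule fin)
  have one: "annihilated \<nu> h (\<lambda>_. 1)"
    using zero by (auto simp: annihilated_def)
  show ?thesis
  proof (rule density_zero[OF h_int])
    fix A assume "A \<in> sets \<nu>"
    then have "annihilated \<nu> h (indicator A)"
      using annihilated_borel[OF cube face one] sets_nu by auto
    then have "(LINT x|\<nu>. h x * indicator A x * expo 0 x) = 0"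
      unfolding annihilated_def using int_lattice_zero by blast
    moreover have "indicator A x *\<^sub>R h x = h x * indicator A x" for x
      by (simp add: indicator_def)
    ultimately show "set_lebesgue_integral \<nu> A h = 0"
      by (simp add: set_lebesgue_integral_def)
  qed
qed

end

subsection \<open>The infinite convolution as the law of a random digit expansion\<close>

text \<open>Entry k holds the pair with number k + 1, so indices start at 0 and every tail
  \<open>\<lambda>j. s (n + j)\<close> is again an object of this type.\<close>

type_synonym 'd digit_seq = "nat \<Rightarrow> ('d \<Rightarrow> int) \<times> (real^'d) set"

definition in_D_seq :: "'d::finite digit_seq \<Rightarrow> bool" where
  "in_D_seq s \<longleftrightarrow> (\<forall>k. in_D (fst (s k)) (snd (s k)))"

definition scale_prod :: "'d::finite digit_seq \<Rightarrow> nat \<Rightarrow> 'd \<Rightarrow> real" where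
  "scale_prod s n i = (\<Prod>k<n. real_of_int (fst (s k) i))"

definition vdiv :: "real^'d::finite \<Rightarrow> ('d \<Rightarrow> real) \<Rightarrow> real^'d" where
  "vdiv x p = (\<chi> i. x $ i / p i)"

lemma vdiv_nth [simp]: "vdiv x p $ i = x $ i / p i"
  by (simp add: vdiv_def)

lemma vdiv_add: "vdiv (x + y) p = vdiv x p + vdiv y p"
  by (simp add: vec_eq_iff add_divide_distrib)

lemma vdiv_zero [simp]: "vdiv 0 p = 0"
  by (simp add: vec_eq_iff)

lemma inner_vdiv: "vdiv a p \<bullet> x = a \<bullet> vdiv x p"
  by (simp add: inner_vec_def)

lemma expo_vdiv: "expo (vdiv a p) x = expo a (vdiv x p)"
  by (simp add: expo_def inner_vdiv)

lemma scale_prod_0 [simp]: "scale_prod s 0 i = 1"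
  by (simp add: scale_prod_def)

lemma scale_prod_Suc: "scale_prod s (Suc n) i = scale_prod s n i * real_of_int (fst (s n) i)"
  by (simp add: scale_prod_def)

lemma scale_prod_add:
  "scale_prod s (n + k) i = scale_prod s n i * scale_prod (\<lambda>j. s (n + j)) k i"
  by (induction k) (simp_all add: scale_prod_Suc)

lemma in_D_seq_shift: "in_D_seq s \<Longrightarrow> in_D_seq (\<lambda>j. s (n + j))"
  by (simp add: in_D_seq_def)

lemma finite_bounded_lattice: "finite {x :: real^'d. \<forall>i. x $ i \<in> \<int> \<and> 0 \<le> x $ i \<and> x $ i \<le> K}"
proof (rule finite_subset)
  let ?A = "{f :: 'd \<Rightarrow> int. range f \<subseteq> {0..\<lfloor>K\<rfloor>}}"
  show "{x :: real^'d. \<forall>i. x $ i \<in> \<int> \<and> 0 \<le> x $ i \<and> x $ i \<le> K} \<subseteq> (\<lambda>f. \<chi> i. real_of_int (f i)) ` ?A"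
  proof
    fix x :: "real^'d" assume x: "x \<in> {x. \<forall>i. x $ i \<in> \<int> \<and> 0 \<le> x $ i \<and> x $ i \<le> K}"
    then have "x = (\<chi> i. real_of_int \<lfloor>x $ i\<rfloor>)"
      by (simp add: vec_eq_iff)
    moreover have "(\<lambda>i. \<lfloor>x $ i\<rfloor>) \<in> ?A"
      using x by (auto intro!: floor_mono)
    ultimately show "x \<in> (\<lambda>f. \<chi> i. real_of_int (f i)) ` ?A" by (rule image_eqI)
  qed
  have "?A = (UNIV \<rightarrow>\<^sub>E {0..\<lfloor>K\<rfloor>})" by (auto simp: PiE_def)
  then show "finite ((\<lambda>f. \<chi> i. real_of_int (f i)) ` ?A :: (real^'d) set)"
    by (simp add: finite_PiE)
qed

lemma in_D_finite:
  fixes m :: "'d::finite \<Rightarrow> int"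
  assumes "in_D m B"
  shows "finite B"
proof (rule finite_subset[OF _ finite_bounded_lattice])
  show "B \<subseteq> {x. \<forall>i. x $ i \<in> \<int> \<and> 0 \<le> x $ i \<and> x $ i \<le> real_of_int (\<Sum>j\<in>UNIV. m j)}"
  proof safe
    fix b i assume b: "b \<in> B"
    show "b $ i \<in> \<int>" "0 \<le> b $ i" using assms b by (auto simp: in_D_def)
    have "m i \<le> (\<Sum>j\<in>UNIV. m j)"
      using assms by (intro member_le_sum) (auto simp: in_D_def intro: order_trans[of 0 2])
    moreover have "b $ i \<le> real_of_int (m i) - 1" using assms b by (auto simp: in_D_def)
    ultimately show "b $ i \<le> real_of_int (\<Sum>j\<in>UNIV. m j)" by linarith
  qed
qed

locale digit_sequence =
  fixes s :: "'d::finite digit_seq"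
  assumes D: "in_D_seq s"
begin

abbreviation "p \<equiv> scale_prod s"

lemma in_D_nth: "in_D (fst (s k)) (snd (s k))"
  using D by (simp add: in_D_seq_def)

lemma digits_finite [simp]: "finite (snd (s k))"
  using in_D_nth by (rule in_D_finite)

lemma digits_nonempty [simp]: "snd (s k) \<noteq> {}"
  using in_D_nth[of k] by (simp add: in_D_def)

lemma base_ge: "2 \<le> real_of_int (fst (s k) i)"
proof -
  have "2 \<le> fst (s k) i" using in_D_nth[of k] by (simp add: in_D_def)
  then show ?thesis by linarith
qed

lemma scale_prod_ge: "2 ^ n \<le> p n i"
proof (induction n)
  case (Suc n)
  have "2 ^ n * 2 \<le> p n i * real_of_int (fst (s n) i)"
    using Suc base_ge order_trans[OF zero_le_power Suc] by (intro mult_mono) auto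
  then show ?case by (simp add: scale_prod_Suc mult.commute)
qed simp

lemma scale_prod_pos [simp]: "0 < p n i"
  using scale_prod_ge[of n i] by (rule less_le_trans[rotated]) simp

lemma scale_prod_nonzero [simp]: "p n i \<noteq> 0"
  using scale_prod_pos[of n i] by linarith

lemma vdiv_shift: "vdiv \<xi> (p (n + k)) = vdiv (vdiv \<xi> (p n)) (scale_prod (\<lambda>j. s (n + j)) k)"
  by (simp add: vec_eq_iff scale_prod_add)

lemma norm_vdiv_le: "norm (vdiv x (p n)) \<le> norm x / 2 ^ n"
proof -
  have "norm (vdiv x (p n)) \<le> norm (x /\<^sub>R 2 ^ n)"
  proof (rule norm_le_componentwise_cart)
    fix i
    have "\<bar>x $ i\<bar> / p n i \<le> \<bar>x $ i\<bar> / 2 ^ n"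
      using scale_prod_ge by (intro divide_left_mono) auto
    then show "norm (vdiv x (p n) $ i) \<le> norm ((x /\<^sub>R 2 ^ n) $ i)"
      by (simp add: abs_mult field_simps abs_of_pos[OF scale_prod_pos])
  qed
  then show ?thesis by (simp add: divide_inverse mult.commute)
qed

definition digit_space :: "(nat \<Rightarrow> real^'d) measure" where
  "digit_space = PiM UNIV (\<lambda>k. measure_pmf (pmf_of_set (snd (s k))))"

definition psum :: "nat \<Rightarrow> (nat \<Rightarrow> real^'d) \<Rightarrow> real^'d" where
  "psum n \<omega> = (\<Sum>k<n. vdiv (\<omega> k) (p (Suc k)))"

definition expansion :: "(nat \<Rightarrow> real^'d) \<Rightarrow> real^'d" where
  "expansion \<omega> = (\<chi> i. \<Sum>k. \<omega> k $ i / p (Suc k) i)"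

definition law :: "(real^'d) measure" where
  "law = distr digit_space borel expansion"

definition ft :: "real^'d \<Rightarrow> complex" where
  "ft \<xi> = (LINT x|law. expo \<xi> x)"

text \<open>This product is the transform of the n-th finite convolution
  (\<open>integral_expo_fconv\<close>); splitting at a level and periodicity can be read off from
  this form.\<close>

definition partial_ft :: "nat \<Rightarrow> real^'d \<Rightarrow> complex" where
  "partial_ft n \<xi> = (\<Prod>k<n. (\<Sum>b\<in>snd (s k). expo (vdiv \<xi> (p (Suc k))) b) / of_nat (card (snd (s k))))"

sublocale DS: product_prob_space "\<lambda>k. measure_pmf (pmf_of_set (snd (s k)))" UNIV
  by unfold_locales

sublocale digit_space: prob_space digit_space
  unfolding digit_space_def by (rule DS.P.prob_space_axioms)

lemma measurable_PiM_digit: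
  assumes "k \<in> I"
  shows "(\<lambda>\<omega>. f (\<omega> k)) \<in> borel_measurable (PiM I (\<lambda>k. measure_pmf (pmf_of_set (snd (s k)))))"
    (is "_ \<in> borel_measurable (PiM I ?M)")
proof -
  have "(\<lambda>\<omega>. \<omega> k) \<in> PiM I ?M \<rightarrow>\<^sub>M ?M k"
    using assms by (rule measurable_component_singleton)
  then have "(\<lambda>\<omega>. \<omega> k) \<in> PiM I ?M \<rightarrow>\<^sub>M count_space UNIV" by (simp add: measurable_def)
  then show ?thesis by (rule measurable_compose) simp
qed

lemma measurable_digit: "(\<lambda>\<omega>. f (\<omega> k)) \<in> borel_measurable digit_space"
  unfolding digit_space_def by (rule measurable_PiM_digit) simp

lemma measurable_psum [measurable]: "psum n \<in> borel_measurable digit_space"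
  unfolding psum_def by (intro borel_measurable_sum measurable_digit)

lemma measurable_expansion [measurable]: "expansion \<in> borel_measurable digit_space"
proof -
  have [measurable]: "(\<lambda>\<omega>. \<omega> k $ i / p (Suc k) i) \<in> borel_measurable digit_space" for k i
    by (rule measurable_digit)
  have "(\<lambda>\<omega>. expansion \<omega> $ i) \<in> borel_measurable digit_space" for i
    unfolding expansion_def by simp
  then show ?thesis
    by (subst borel_measurable_euclidean_space) (auto simp: Basis_vec_def inner_axis)
qed

lemma sets_law [measurable_cong, simp]: "sets law = sets borel"
  by (simp add: law_def)

lemma space_law [simp]: "space law = UNIV"
  by (simp add: law_def)

sublocale law: prob_space law
  unfolding law_def by (intro digit_space.prob_space_distr) measurable

lemma AE_digits: "AE \<omega> in digit_space. \<forall>k. \<omega> k \<in> snd (s k)"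
  unfolding AE_all_countable digit_space_def
  by (intro allI DS.AE_component) (auto simp: AE_measure_pmf_iff)

context
  fixes \<omega> :: "nat \<Rightarrow> real^'d"
  assumes \<omega>: "\<forall>k. \<omega> k \<in> snd (s k)"
begin

lemma digit_nonneg: "0 \<le> \<omega> k $ i / p (Suc k) i"
proof -
  have "0 \<le> \<omega> k $ i" using \<omega> in_D_nth[of k] by (auto simp: in_D_def)
  then show ?thesis by (intro divide_nonneg_pos) auto
qed

text \<open>The contributions of maximal digits telescope to 1. Comparison with them puts the
  expansion into the unit cube and shows when a coordinate can equal 1.\<close>

lemma top_digit: "(real_of_int (fst (s k) i) - 1) / p (Suc k) i = 1 / p k i - 1 / p (Suc k) i"
  using base_ge[of k i] by (simp add: scale_prod_Suc field_simps)

lemma digit_le: "\<omega> k $ i / p (Suc k) i \<le> 1 / p k i - 1 / p (Suc k) i"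
proof -
  have "\<omega> k $ i \<le> real_of_int (fst (s k) i) - 1" using \<omega> in_D_nth[of k] by (auto simp: in_D_def)
  then have "\<omega> k $ i / p (Suc k) i \<le> (real_of_int (fst (s k) i) - 1) / p (Suc k) i"
    by (intro divide_right_mono) (auto intro: less_imp_le)
  then show ?thesis by (simp add: top_digit)
qed

lemma top_sums: "(\<lambda>k. 1 / p k i - 1 / p (Suc k) i) sums 1"
proof -
  have "(\<lambda>k. 1 / p k i) \<longlonglongrightarrow> 0"
  proof (rule tendsto_sandwich[of "\<lambda>_. 0" _ _ "\<lambda>k. (1 / 2) ^ k"])
    show "\<forall>\<^sub>F k in sequentially. 1 / p k i \<le> (1 / 2) ^ k"
      using scale_prod_ge by (intro always_eventually) (auto simp: power_divide intro!: divide_left_mono)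
  qed (auto intro!: LIMSEQ_realpow_zero always_eventually less_imp_le)
  then show ?thesis using telescope_sums'[of "\<lambda>k. 1 / p k i" 0] by simp
qed

lemma digits_summable: "summable (\<lambda>k. \<omega> k $ i / p (Suc k) i)"
  by (rule summable_comparison_test'[OF sums_summable[OF top_sums[of i]], of 0])
     (simp only: real_norm_def abs_of_nonneg[OF digit_nonneg] digit_le)

lemma expansion_cube: "0 \<le> expansion \<omega> $ i" "expansion \<omega> $ i \<le> 1"
proof -
  show "0 \<le> expansion \<omega> $ i"
    unfolding expansion_def using digit_nonneg digits_summable by (simp add: suminf_nonneg)
  have "expansion \<omega> $ i \<le> (\<Sum>k. 1 / p k i - 1 / p (Suc k) i)"
    unfolding expansion_def vec_lambda_beta
    by (intro suminf_le digits_summable sums_summable[OF top_sums] digit_le)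
  then show "expansion \<omega> $ i \<le> 1" using sums_unique[OF top_sums[of i]] by simp
qed

lemma expansion_eq_0: "expansion \<omega> $ i = 0 \<Longrightarrow> \<omega> k $ i = 0"
  using suminf_eq_zero_iff[OF digits_summable digit_nonneg] by (simp add: expansion_def)

lemma expansion_eq_1:
  assumes "expansion \<omega> $ i = 1"
  shows "\<omega> k $ i = real_of_int (fst (s k) i) - 1"
proof -
  let ?f = "\<lambda>k. (1 / p k i - 1 / p (Suc k) i) - \<omega> k $ i / p (Suc k) i"
  have "?f sums (1 - 1)"
    using top_sums summable_sums[OF digits_summable] assms
    by (intro sums_diff) (simp_all add: expansion_def sums_iff)
  then have "summable ?f" "suminf ?f = 0" by (auto simp: sums_iff)
  then have "?f k = 0"
    using suminf_eq_zero_iff[of ?f] digit_le[of _ i] by auto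
  then have "(real_of_int (fst (s k) i) - 1) / p (Suc k) i = \<omega> k $ i / p (Suc k) i"
    by (simp add: top_digit)
  then show ?thesis by simp
qed

lemma psum_tendsto: "(\<lambda>n. psum n \<omega>) \<longlonglongrightarrow> expansion \<omega>"
proof (rule vec_tendstoI)
  fix i
  show "(\<lambda>n. psum n \<omega> $ i) \<longlonglongrightarrow> expansion \<omega> $ i"
    using summable_LIMSEQ[OF digits_summable[of i]] by (simp add: psum_def expansion_def)
qed

end

lemma law_cube: "AE x in law. 0 \<le> x $ i \<and> x $ i \<le> 1"
  unfolding law_def
  by (subst AE_distr_iff) (use AE_digits expansion_cube in \<open>auto elim!: eventually_mono\<close>)


text \<open>The same measures as \<open>fin_conv\<close>, with the inverse matrix written as
  coordinatewise division and the uniform digit law pushed forward along it; see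
  \<open>fin_conv_eq_fconv\<close>.\<close>

fun fconv :: "nat \<Rightarrow> (real^'d) pmf" where
  "fconv 0 = return_pmf 0"
| "fconv (Suc n) = conv_pmf (fconv n) (map_pmf (\<lambda>b. vdiv b (p (Suc n))) (pmf_of_set (snd (s n))))"

lemma finite_fconv: "finite (set_pmf (fconv n))"
  by (induction n) (auto simp: conv_pmf_def)

text \<open>Fubini, integrating out the last digit first. The inner integral is a new integrand for
  the remaining digits, so the induction keeps \<open>g\<close> arbitrary.\<close>

lemma nn_integral_psum_finite:
  assumes "g \<in> borel_measurable borel"
  shows "(\<integral>\<^sup>+\<omega>. g (psum n \<omega>) \<partial>PiM {..<n} (\<lambda>k. measure_pmf (pmf_of_set (snd (s k))))) =
    (\<integral>\<^sup>+x. g x \<partial>measure_pmf (fconv n))"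
  using assms
proof (induction n arbitrary: g)
  case 0
  interpret E: product_prob_space "\<lambda>k. measure_pmf (pmf_of_set (snd (s k)))" "{}" by unfold_locales
  show ?case using 0 by (simp add: psum_def PiM_empty nn_integral_count_space_finite)
next
  case (Suc n)
  let ?M = "\<lambda>k. measure_pmf (pmf_of_set (snd (s k)))"
  note [measurable] = Suc.prems
  have "psum (Suc n) \<in> borel_measurable (PiM {..<Suc n} ?M)"
    unfolding psum_def by (intro borel_measurable_sum measurable_PiM_digit) auto
  then have gm: "(\<lambda>\<omega>. g (psum (Suc n) \<omega>)) \<in> borel_measurable (PiM (insert n {..<n}) ?M)"
    unfolding lessThan_Suc[symmetric] by measurable
  let ?g = "\<lambda>u. \<integral>\<^sup>+y. g (u + vdiv y (p (Suc n))) \<partial>?M n"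
  have "?g = (\<lambda>u. (\<Sum>b\<in>snd (s n). g (u + vdiv b (p (Suc n)))) / of_nat (card (snd (s n))))"
    by (simp add: nn_integral_pmf_of_set)
  then have g': "?g \<in> borel_measurable borel"
    by simp
  have "psum (Suc n) (fun_upd \<omega> n y) = psum n \<omega> + vdiv y (p (Suc n))" for \<omega> y
    by (simp add: psum_def)
  then have "(\<integral>\<^sup>+\<omega>. g (psum (Suc n) \<omega>) \<partial>PiM {..<Suc n} ?M) = (\<integral>\<^sup>+\<omega>. ?g (psum n \<omega>) \<partial>PiM {..<n} ?M)"
    unfolding lessThan_Suc by (subst DS.product_nn_integral_insert[OF _ _ gm]) auto
  also have "\<dots> = (\<integral>\<^sup>+x. ?g x \<partial>measure_pmf (fconv n))"
    by (rule Suc.IH[OF g'])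
  also have "\<dots> = (\<integral>\<^sup>+x. g x \<partial>measure_pmf (fconv (Suc n)))"
    by (simp add: conv_pmf_def)
  finally show ?case .
qed

text \<open>\<open>psum n\<close> reads the first n digits only, which reduces the infinite product
  to a finite one. The pmf is pushed to \<open>borel\<close> because its own sigma-algebra is
  discrete.\<close>

lemma distr_psum: "distr digit_space borel (psum n) = distr (measure_pmf (fconv n)) borel (\<lambda>x. x)"
proof (rule measure_eqI)
  fix A assume "A \<in> sets (distr digit_space borel (psum n))"
  then have [measurable]: "A \<in> sets borel" by simp
  let ?M = "\<lambda>k. measure_pmf (pmf_of_set (snd (s k)))"
  have [measurable]: "psum n \<in> borel_measurable (PiM {..<n} ?M)"
    unfolding psum_def by (intro borel_measurable_sum measurable_PiM_digit) auto
  have "emeasure (distr digit_space borel (psum n)) A = (\<integral>\<^sup>+\<omega>. indicator A (psum n \<omega>) \<partial>digit_space)"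
    by (subst nn_integral_distr[symmetric, of "psum n" digit_space borel "indicator A"]) auto
  also have "\<dots> = (\<integral>\<^sup>+\<omega>. indicator A (psum n (restrict \<omega> {..<n})) \<partial>digit_space)"
    by (simp add: psum_def)
  also have "\<dots> = (\<integral>\<^sup>+\<omega>. indicator A (psum n \<omega>) \<partial>distr digit_space (PiM {..<n} ?M) (\<lambda>\<omega>. restrict \<omega> {..<n}))"
    unfolding digit_space_def
    by (subst nn_integral_distr) (auto intro!: measurable_restrict_subset)
  also have "\<dots> = (\<integral>\<^sup>+\<omega>. indicator A (psum n \<omega>) \<partial>PiM {..<n} ?M)"
    unfolding digit_space_def by (subst DS.distr_PiM_restrict_finite) auto
  also have "\<dots> = (\<integral>\<^sup>+x. indicator A x \<partial>measure_pmf (fconv n))"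
    by (rule nn_integral_psum_finite) simp
  also have "\<dots> = emeasure (distr (measure_pmf (fconv n)) borel (\<lambda>x. x)) A"
    by (simp add: emeasure_distr)
  finally show "emeasure (distr digit_space borel (psum n)) A =
    emeasure (distr (measure_pmf (fconv n)) borel (\<lambda>x. x)) A" .
qed simp

lemma integral_psum:
  fixes f :: "real^'d \<Rightarrow> 'b::{banach, second_countable_topology}"
  assumes [measurable]: "f \<in> borel_measurable borel"
  shows "(LINT \<omega>|digit_space. f (psum n \<omega>)) = (LINT x|measure_pmf (fconv n). f x)"
proof -
  have "(LINT \<omega>|digit_space. f (psum n \<omega>)) = (LINT x|distr digit_space borel (psum n). f x)"
    by (subst integral_distr) auto
  also have "\<dots> = (LINT x|measure_pmf (fconv n). f x)"
    by (subst distr_psum, subst integral_distr) auto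
  finally show ?thesis .
qed

text \<open>All finite convolutions are realised on the one space \<open>digit_space\<close>, where
  the partial sums converge almost surely; bounded convergence then yields weak convergence to
  \<open>law\<close>.\<close>

lemma fconv_tendsto:
  fixes f :: "real^'d \<Rightarrow> 'b::{banach, second_countable_topology}"
  assumes f: "continuous_on UNIV f" and bnd: "\<And>x. norm (f x) \<le> C"
  shows "(\<lambda>n. LINT x|measure_pmf (fconv n). f x) \<longlonglongrightarrow> (LINT x|law. f x)"
proof -
  have [measurable]: "f \<in> borel_measurable borel" using f by (rule borel_measurable_continuous_onI)
  have "(\<lambda>n. LINT \<omega>|digit_space. f (psum n \<omega>)) \<longlonglongrightarrow> (LINT \<omega>|digit_space. f (expansion \<omega>))"
  proof (rule integral_dominated_convergence[where w = "\<lambda>_. C"])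
    show "AE \<omega> in digit_space. (\<lambda>n. f (psum n \<omega>)) \<longlonglongrightarrow> f (expansion \<omega>)"
      using AE_digits
      by eventually_elim (intro continuous_on_tendsto_compose[OF f psum_tendsto], auto)
  qed (auto simp: bnd)
  moreover have "(LINT x|law. f x) = (LINT \<omega>|digit_space. f (expansion \<omega>))"
    unfolding law_def by (subst integral_distr) auto
  ultimately show ?thesis by (simp add: integral_psum)
qed

lemma integral_expo_fconv: "(LINT x|measure_pmf (fconv n). expo \<xi> x) = partial_ft n \<xi>"
proof (induction n)
  case 0
  show ?case by (simp add: partial_ft_def expo_def)
next
  case (Suc n)
  let ?q = "map_pmf (\<lambda>b. vdiv b (p (Suc n))) (pmf_of_set (snd (s n)))"
  have "(LINT x|measure_pmf (fconv (Suc n)). expo \<xi> x) =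
      (\<Sum>a\<in>set_pmf (fconv n). pmf (fconv n) a *\<^sub>R (LINT y|measure_pmf (map_pmf (\<lambda>y. a + y) ?q). expo \<xi> y))"
    unfolding fconv.simps conv_pmf_def by (intro pmf_expectation_bind finite_fconv) auto
  also have "\<dots> = (\<Sum>a\<in>set_pmf (fconv n). pmf (fconv n) a *\<^sub>R expo \<xi> a) * (LINT y|measure_pmf ?q. expo \<xi> y)"
    by (simp add: expo_commute[of \<xi>] expo_add sum_distrib_right)
  also have "(\<Sum>a\<in>set_pmf (fconv n). pmf (fconv n) a *\<^sub>R expo \<xi> a) = partial_ft n \<xi>"
    by (subst Suc[symmetric], subst integral_measure_pmf[OF finite_fconv]) auto
  also have "(LINT y|measure_pmf ?q. expo \<xi> y) =
      (\<Sum>b\<in>snd (s n). expo (vdiv \<xi> (p (Suc n))) b) / of_nat (card (snd (s n)))"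
    by (subst integral_map_pmf, subst integral_measure_pmf[OF digits_finite[of n]])
       (auto simp: expo_vdiv sum_divide_distrib scaleR_conv_of_real)
  finally show ?case by (simp add: partial_ft_def)
qed

lemma partial_ft_tendsto: "(\<lambda>n. partial_ft n \<xi>) \<longlonglongrightarrow> ft \<xi>"
  using fconv_tendsto[of "expo \<xi>" 1] by (simp add: integral_expo_fconv ft_def continuous_on_expo)

lemma ft_zero [simp]: "ft 0 = 1"
  using law.prob_space by (simp add: ft_def)

text \<open>Combines \<open>|exp (i u) - 1| \<le> |u|\<close>, Cauchy-Schwarz, and the bound
  \<open>CARD('d)\<close> for the norm on the unit cube. The constant does not depend on
  \<open>s\<close>, so the transforms of all digit sequences are equicontinuous.\<close>

lemma ft_lipschitz: "norm (ft a - ft b) \<le> 2 * pi * CARD('d) * norm (a - b)"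
proof -
  have int: "integrable law (expo a)" for a
    by (rule law.integrable_const_bound[where B = 1]) (simp, measurable)
  have e: "norm (expo a x - expo b x) \<le> 2 * pi * norm (a - b) * norm x" for x
  proof -
    have "expo a x - expo b x = expo b x * (iexp (2 * pi * ((a - b) \<bullet> x)) - 1)"
      using expo_add[of "a - b" b x] by (simp add: algebra_simps expo_def)
    also have "norm \<dots> \<le> \<bar>2 * pi * ((a - b) \<bullet> x)\<bar>"
      using iexp_approx1[of "2 * pi * ((a - b) \<bullet> x)" 0] by (simp add: norm_mult)
    also have "\<dots> \<le> 2 * pi * (norm (a - b) * norm x)"
      unfolding abs_mult using Cauchy_Schwarz_ineq2[of "a - b" x] by simp
    finally show ?thesis by simp
  qed
  have "AE x in law. \<forall>i. 0 \<le> x $ i \<and> x $ i \<le> 1"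
    unfolding AE_all_countable using law_cube by blast
  then have AE: "AE x in law. norm (expo a x - expo b x) \<le> 2 * pi * CARD('d) * norm (a - b)"
  proof eventually_elim
    case (elim x)
    have "norm x \<le> (\<Sum>i\<in>UNIV. \<bar>x $ i\<bar>)" by (rule norm_le_l1_cart)
    also have "\<dots> \<le> (\<Sum>i\<in>(UNIV::'d set). 1)" using elim by (intro sum_mono) auto
    finally have "2 * pi * norm (a - b) * norm x \<le> 2 * pi * norm (a - b) * CARD('d)"
      by (intro mult_left_mono) auto
    from order_trans[OF e[of x] this] show ?case by (simp add: mult_ac)
  qed
  have "norm (ft a - ft b) = norm (LINT x|law. expo a x - expo b x)"
    unfolding ft_def using int by simp
  also have "\<dots> \<le> (LINT x|law. norm (expo a x - expo b x))"
    by (rule integral_norm_bound)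
  also have "\<dots> \<le> 2 * pi * CARD('d) * norm (a - b)"
    using AE int by (intro law.integral_le_const) auto
  finally show ?thesis .
qed

end

section \<open>Tails of the sequence and the mass on opposite faces\<close>

lemma digit_sequence_shift: "digit_sequence s \<Longrightarrow> digit_sequence (\<lambda>j. s (n + j))"
  by (simp add: digit_sequence_def in_D_seq_shift)

text \<open>Every index with \<open>q k \<le> r\<close> contributes a factor at most
  \<open>r\<close>, no index raises the product, and there are infinitely many such indices.\<close>

lemma prod_le_power:
  fixes q :: "nat \<Rightarrow> real"
  assumes q: "\<And>k. 0 \<le> q k" "\<And>k. q k \<le> 1" and r: "\<exists>\<^sub>\<infinity>k. q k \<le> r"
  shows "\<exists>n. (\<Prod>k<n. q k) \<le> r ^ j"
proof (induction j)
  case 0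
  show ?case by (rule exI[of _ 0]) simp
next
  case (Suc j)
  have mono: "(\<Prod>k<n. q k) \<le> (\<Prod>k<m. q k)" if "m \<le> n" for m n
    using that
  proof (induction n rule: dec_induct)
    case (step n)
    have "(\<Prod>k<n. q k) * q n \<le> (\<Prod>k<n. q k)"
      using q by (intro mult_right_le_one_le prod_nonneg) auto
    then show ?case using step by simp
  qed simp
  from Suc obtain n where n: "(\<Prod>k<n. q k) \<le> r ^ j" by blast
  from r obtain k where k: "k \<ge> n" "q k \<le> r" by (auto simp: INFM_nat_le)
  have "0 \<le> r" using q(1)[of k] k by linarith
  have "(\<Prod>i<Suc k. q i) = q k * (\<Prod>i<k. q i)" by simp
  also have "\<dots> \<le> r * r ^ j"
    using k q n mono[OF k(1)] \<open>0 \<le> r\<close> by (intro mult_mono prod_nonneg) auto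
  finally show ?case by (intro exI[of _ "Suc k"]) simp
qed

context digit_sequence
begin

lemma partial_ft_Suc: "partial_ft (Suc n) \<xi> = partial_ft n \<xi> *
    ((\<Sum>b\<in>snd (s n). expo (vdiv \<xi> (p (Suc n))) b) / of_nat (card (snd (s n))))"
  by (simp add: partial_ft_def)

lemma partial_ft_0 [simp]: "partial_ft 0 \<xi> = 1"
  by (simp add: partial_ft_def)

lemma partial_ft_add:
  "partial_ft (n + k) \<xi> = partial_ft n \<xi> * digit_sequence.partial_ft (\<lambda>j. s (n + j)) k (vdiv \<xi> (p n))"
proof -
  interpret T: digit_sequence "\<lambda>j. s (n + j)" by (rule digit_sequence_shift) unfold_locales
  show ?thesis
    by (induction k) (simp_all add: partial_ft_Suc T.partial_ft_Suc vdiv_shift[symmetric])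
qed

lemma ft_shift: "ft \<xi> = partial_ft n \<xi> * digit_sequence.ft (\<lambda>j. s (n + j)) (vdiv \<xi> (p n))"
proof -
  interpret T: digit_sequence "\<lambda>j. s (n + j)" by (rule digit_sequence_shift) unfold_locales
  have "(\<lambda>k. partial_ft (n + k) \<xi>) \<longlonglongrightarrow> ft \<xi>"
    using LIMSEQ_ignore_initial_segment[OF partial_ft_tendsto[of \<xi>], of n] by (simp add: add.commute)
  moreover have "(\<lambda>k. partial_ft (n + k) \<xi>) \<longlonglongrightarrow> partial_ft n \<xi> * T.ft (vdiv \<xi> (p n))"
    unfolding partial_ft_add by (intro tendsto_intros T.partial_ft_tendsto)
  ultimately show ?thesis by (rule LIMSEQ_unique)
qed

text \<open>\<open>E n\<close> says that the first n digits all follow \<open>d\<close>; its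
  probability is the product of the \<open>q k\<close>. Where another digit is available,
  \<open>q k \<le> 1 - 1 / C\<close> by the bound on the number of digits, and this happens
  infinitely often.\<close>

lemma AE_not_constant_digits:
  assumes card: "\<And>k. card (snd (s k)) \<le> C"
    and inf: "\<exists>\<^sub>\<infinity>k. \<exists>b\<in>snd (s k). b $ i \<noteq> d k"
  shows "AE \<omega> in digit_space. \<exists>k. \<omega> k $ i \<noteq> d k"
proof -
  let ?M = "\<lambda>k. measure_pmf (pmf_of_set (snd (s k)))"
  define q where "q k = measure (?M k) {b. b $ i = d k}" for k
  define r where "r = 1 - 1 / real C"
  define E where "E n = prod_emb UNIV ?M {..<n} (PiE {..<n} (\<lambda>k. {b. b $ i = d k}))" for n
  have C: "C > 0"
  proof -
    have "card (snd (s 0)) > 0" by (simp add: card_gt_0_iff)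
    then show ?thesis using card[of 0] by linarith
  qed
  have r: "0 \<le> r" "r < 1" using C by (auto simp: r_def)
  have q: "0 \<le> q k" "q k \<le> 1" for k by (auto simp: q_def)
  have qr: "q k \<le> r" if "\<exists>b\<in>snd (s k). b $ i \<noteq> d k" for k
  proof -
    let ?B = "snd (s k)"
    from that obtain b where b: "b \<in> ?B" "b $ i \<noteq> d k" by blast
    have "card (?B \<inter> {b. b $ i = d k}) < card ?B"
      using b by (intro psubset_card_mono) auto
    then have "real (card (?B \<inter> {b. b $ i = d k})) \<le> real (card ?B) - 1" by linarith
    then have "q k \<le> (real (card ?B) - 1) / real (card ?B)"
      by (simp add: q_def measure_pmf_of_set divide_right_mono)
    also have "\<dots> = 1 - 1 / real (card ?B)"
      using digits_nonempty[of k] by (simp add: field_simps card_eq_0_iff del: digits_nonempty)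
    also have "\<dots> \<le> r"
      using card[of k] C by (simp add: r_def frac_le card_gt_0_iff)
    finally show ?thesis .
  qed
  have inf': "\<exists>\<^sub>\<infinity>k. q k \<le> r" using inf by (rule INFM_mono) (rule qr)
  have E: "E n \<in> sets digit_space" for n
    unfolding E_def digit_space_def by (intro sets_PiM_I) auto
  have mE: "measure digit_space (E n) = (\<Prod>k<n. q k)" for n
  proof -
    have "emeasure digit_space (E n) = (\<Prod>k<n. emeasure (?M k) {b. b $ i = d k})"
      unfolding digit_space_def E_def by (rule emeasure_PiM_emb) (auto intro: measure_pmf.prob_space_axioms)
    also have "\<dots> = ennreal (\<Prod>k<n. q k)"
      by (simp add: measure_pmf.emeasure_eq_measure q_def prod_ennreal)
    finally show ?thesis using q by (simp add: measure_def prod_nonneg)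
  qed
  have null: "measure digit_space (\<Inter>n. E n) = 0"
  proof (rule antisym)
    have "measure digit_space (\<Inter>n. E n) \<le> r ^ j" for j
    proof -
      obtain n where "(\<Prod>k<n. q k) \<le> r ^ j" using prod_le_power[OF q inf'] by blast
      moreover have "measure digit_space (\<Inter>n. E n) \<le> measure digit_space (E n)"
        using E by (intro digit_space.finite_measure_mono) auto
      ultimately show ?thesis using mE by simp
    qed
    moreover have "(\<lambda>j. r ^ j) \<longlonglongrightarrow> 0" using r by (intro LIMSEQ_realpow_zero)
    ultimately show "measure digit_space (\<Inter>n. E n) \<le> 0"
      by (intro LIMSEQ_le_const) auto
  qed simp
  have "(\<Inter>n. E n) \<in> null_sets digit_space"
    using null E by (auto simp: null_sets_def digit_space.emeasure_eq_measure)
  then have "AE \<omega> in digit_space. \<omega> \<notin> (\<Inter>n. E n)" by (rule AE_not_in)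
  then show ?thesis
  proof eventually_elim
    case (elim \<omega>)
    show ?case
    proof (rule ccontr)
      assume "\<not> ?case"
      then have "\<omega> \<in> E n" for n
        by (simp add: E_def prod_emb_def)
      then show False using elim by blast
    qed
  qed
qed

text \<open>Both opposite faces could only have positive mass if almost all digits were forced to be
  simultaneously minimal and maximal.\<close>
lemma law_face:
  assumes card: "\<And>k. card (snd (s k)) \<le> C"
  shows "(AE x in law. x $ i \<noteq> 0) \<or> (AE x in law. x $ i \<noteq> 1)"
proof -
  have "(\<exists>\<^sub>\<infinity>k. \<exists>b\<in>snd (s k). b $ i \<noteq> 0) \<or> (\<exists>\<^sub>\<infinity>k. \<exists>b\<in>snd (s k). b $ i \<noteq> real_of_int (fst (s k) i) - 1)"
    (is "?A \<or> ?B")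
  proof -
    have "(\<exists>b\<in>snd (s k). b $ i \<noteq> 0) \<or> (\<exists>b\<in>snd (s k). b $ i \<noteq> real_of_int (fst (s k) i) - 1)" for k
    proof -
      obtain b where "b \<in> snd (s k)" using digits_nonempty by blast
      \<comment> \<open>A base of at least 2 separates the minimal digit 0 from the maximal one, so
        one digit cannot be both.\<close>
      then show ?thesis using base_ge[of k i] by (cases "b $ i = 0") auto
    qed
    then have "\<exists>\<^sub>\<infinity>k. (\<exists>b\<in>snd (s k). b $ i \<noteq> 0) \<or> (\<exists>b\<in>snd (s k). b $ i \<noteq> real_of_int (fst (s k) i) - 1)"
      by (auto simp: INFM_nat)
    then show ?thesis by (simp only: INFM_disj_distrib)
  qed
  then show ?thesis
  proof
    assume ?A
    then have "AE \<omega> in digit_space. \<exists>k. \<omega> k $ i \<noteq> 0"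
      by (rule AE_not_constant_digits[OF card])
    then have "AE \<omega> in digit_space. expansion \<omega> $ i \<noteq> 0"
      using AE_digits by eventually_elim (use expansion_eq_0 in blast)
    then show ?thesis unfolding law_def by (intro disjI1, subst AE_distr_iff) auto
  next
    assume ?B
    then have "AE \<omega> in digit_space. \<exists>k. \<omega> k $ i \<noteq> real_of_int (fst (s k) i) - 1"
      by (rule AE_not_constant_digits[OF card])
    then have "AE \<omega> in digit_space. expansion \<omega> $ i \<noteq> 1"
      using AE_digits by eventually_elim (use expansion_eq_1 in blast)
    then show ?thesis unfolding law_def by (intro disjI2, subst AE_distr_iff) auto
  qed
qed

lemma law_fourier_uniqueness:
  assumes card: "\<And>k. card (snd (s k)) \<le> C" and h: "integrable law h"
    and zero: "\<And>k. k \<in> int_lattice \<Longrightarrow> (LINT x|law. h x * expo k x) = 0"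
  shows "AE x in law. h x = 0"
  by (rule fourier_uniqueness_cube[OF sets_law h law_cube law_face[OF card] law.finite_measure_axioms zero])

text \<open>If the transform vanished on the whole translate, the function \<open>expo x\<close>
  would have only zero coefficients and so be 0 almost everywhere, against its modulus 1.\<close>

lemma ft_nonzero_translate:
  assumes card: "\<And>k. card (snd (s k)) \<le> C"
  shows "\<exists>k\<in>int_lattice. ft (x + k) \<noteq> 0"
proof (rule ccontr)
  assume "\<not> ?thesis"
  then have "(LINT y|law. expo x y * expo k y) = 0" if "k \<in> int_lattice" for k
    using that by (auto simp: ft_def expo_add)
  moreover have "integrable law (expo x)"
    by (rule law.integrable_const_bound[where B = 1]) (simp, measurable)
  ultimately have "AE y in law. expo x y = 0"
    using law_fourier_uniqueness[OF card] by blast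
  moreover have "expo x y \<noteq> 0" for y using norm_expo[of x y] by force
  ultimately have "AE y in law. False" by simp
  then show False using law.prob_space by (simp add: law.AE_False)
qed

end

section \<open>Identification of the weak limit with the law\<close>

lemma finite_measure_eqI_continuous:
  fixes M N :: "'a::metric_space measure"
  assumes "finite_measure M" "finite_measure N" and sets: "sets M = sets borel" "sets N = sets borel"
    and eq: "\<And>f :: 'a \<Rightarrow> real. continuous_on UNIV f \<Longrightarrow> bounded (range f) \<Longrightarrow>
      integral\<^sup>L M f = integral\<^sup>L N f"
  shows "M = N"
proof -
  interpret M: finite_measure M by fact
  interpret N: finite_measure N by fact
  note [measurable_cong] = sets
  \<comment> \<open>Continuous cut-offs recover the measure of a closed set; the closed sets then
    serve as an intersection-stable generator.\<close>
  have lim: "(\<lambda>n. LINT x|Q. max 0 (1 - real n * infdist x S)) \<longlonglongrightarrow> measure Q S"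
    if "finite_measure Q" and [measurable_cong]: "sets Q = sets borel" and S: "closed S" "S \<noteq> {}" for Q S
  proof -
    interpret Q: finite_measure Q by fact
    have [measurable]: "S \<in> sets borel" using S by simp
    let ?f = "\<lambda>n z. max 0 (1 - real n * infdist z S)"
    have [measurable]: "(\<lambda>z. infdist z S) \<in> borel_measurable borel"
      by (intro borel_measurable_continuous_onI continuous_intros)
    have "(\<lambda>n. LINT x|Q. ?f n x) \<longlonglongrightarrow> (LINT x|Q. indicator S x)"
    proof (rule integral_dominated_convergence[where w = "\<lambda>_. 1"])
      show "AE x in Q. (\<lambda>n. ?f n x) \<longlonglongrightarrow> indicator S x"
        by (intro AE_I2 infdist_tendsto_indicator S)
      show "AE x in Q. norm (?f n x) \<le> 1" for n
        by (intro AE_I2) (auto intro!: mult_nonneg_nonneg infdist_nonneg)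
    qed measurable
    then show ?thesis using sets_eq_imp_space_eq[OF that(2)] by simp
  qed
  have closed: "measure M S = measure N S" if S: "closed S" for S
  proof (cases "S = {}")
    case False
    have "(LINT x|M. max 0 (1 - real n * infdist x S)) = (LINT x|N. max 0 (1 - real n * infdist x S))" for n
    proof (rule eq)
      have "max 0 (1 - real n * infdist x S) \<in> {0..1}" for x
        by (auto intro!: mult_nonneg_nonneg infdist_nonneg)
      then have "range (\<lambda>x. max 0 (1 - real n * infdist x S)) \<subseteq> {0..1}" by blast
      then show "bounded (range (\<lambda>x. max 0 (1 - real n * infdist x S)))"
        by (rule bounded_subset[OF bounded_closed_interval])
    qed (intro continuous_intros)
    then show ?thesis
      using lim[OF \<open>finite_measure M\<close> sets(1) S False] lim[OF \<open>finite_measure N\<close> sets(2) S False]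
      by (auto intro: LIMSEQ_unique)
  qed simp
  show ?thesis
  proof (rule measure_eqI_generator_eq[where E = "Collect closed" and \<Omega> = UNIV and A = "\<lambda>_. UNIV"])
    show "Int_stable (Collect closed :: 'a set set)" by (auto simp: Int_stable_def)
    show "sets M = sigma_sets UNIV (Collect closed)" "sets N = sigma_sets UNIV (Collect closed)"
      using sets by (simp_all add: borel_eq_closed)
    show "emeasure M X = emeasure N X" if "X \<in> Collect closed" for X
      using that closed by (simp add: M.emeasure_eq_measure N.emeasure_eq_measure)
  qed auto
qed

definition diag :: "('d \<Rightarrow> real) \<Rightarrow> real^'d::finite^'d" where
  "diag a = (\<chi> i j. if i = j then a i else 0)"

lemma diag_mat_eq: "diag_mat m = diag (\<lambda>i. real_of_int (m i))"
  by (simp add: diag_mat_def diag_def)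

lemma diag_mult: "diag a ** diag b = diag (\<lambda>i. a i * b i)"
  by (simp add: diag_def matrix_matrix_mult_def vec_eq_iff if_distrib[of "\<lambda>x. x * _"] sum.If_cases)

lemma mat_1_eq_diag: "mat 1 = diag (\<lambda>_. 1)"
  by (simp add: mat_def diag_def)

lemma diag_vmult: "diag a *v x = (\<chi> i. a i * x $ i)"
  by (simp add: diag_def matrix_vector_mult_def vec_eq_iff if_distrib[of "\<lambda>x. x * _"] sum.If_cases)

lemma matrix_inv_diag:
  assumes "\<And>i. a i \<noteq> 0"
  shows "matrix_inv (diag a) *v x = vdiv x a"
proof -
  let ?B = "diag (\<lambda>i. 1 / a i)"
  have B: "diag a ** ?B = mat 1" "?B ** diag a = mat 1"
    using assms by (simp_all add: diag_mult mat_1_eq_diag)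
  then have "diag a ** matrix_inv (diag a) = mat 1 \<and> matrix_inv (diag a) ** diag a = mat 1"
    unfolding matrix_inv_def by (intro someI_ex[of "\<lambda>A'. diag a ** A' = mat 1 \<and> A' ** diag a = mat 1"]) blast
  then have inv: "matrix_inv (diag a) = ?B"
    using B by (metis matrix_mul_assoc matrix_mul_lid matrix_mul_rid)
  show ?thesis unfolding inv by (simp add: diag_vmult vec_eq_iff)
qed

lemma mat_prod_diag: "mat_prod (\<lambda>k. diag_mat (m k)) n = diag (scale_prod (\<lambda>k. (m (Suc k), B (Suc k))) n)"
  by (induction n) (simp_all add: mat_1_eq_diag diag_mat_eq diag_mult scale_prod_Suc fun_eq_iff mult.commute)

context digit_sequence
begin

lemma fin_conv_eq_fconv:
  assumes "s = (\<lambda>k. (m (Suc k), B (Suc k)))"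
  shows "fin_conv (\<lambda>k. diag_mat (m k)) B n = fconv n"
proof (induction n)
  case (Suc n)
  have eq: "(*v) (matrix_inv (mat_prod (\<lambda>k. diag_mat (m k)) (Suc n))) = (\<lambda>b. vdiv b (p (Suc n)))"
    unfolding mat_prod_diag[of m _ B] assms[symmetric]
    by (intro ext matrix_inv_diag scale_prod_nonzero)
  \<comment> \<open>Injectivity turns the uniform law on the image into the image of the uniform
    law.\<close>
  have "inj_on (\<lambda>b. vdiv b (p (Suc n))) (snd (s n))"
    by (auto simp: inj_on_def vec_eq_iff)
  then have "delta_set ((\<lambda>b. vdiv b (p (Suc n))) ` snd (s n)) =
      map_pmf (\<lambda>b. vdiv b (p (Suc n))) (pmf_of_set (snd (s n)))"
    by (simp add: delta_set_def map_pmf_of_set_inj)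
  moreover have "B (Suc n) = snd (s n)" using assms by simp
  ultimately show ?case using Suc by (simp only: fin_conv.simps fconv.simps eq)
qed simp

lemma weak_limit_eq_law:
  assumes "prob_space \<mu>" "sets \<mu> = sets borel" and "weak_conv (\<lambda>n. measure_pmf (fconv n)) \<mu>"
  shows "\<mu> = law"
proof (rule finite_measure_eqI_continuous)
  fix f :: "real^'d \<Rightarrow> real"
  assume f: "continuous_on UNIV f" "bounded (range f)"
  then obtain C where "\<And>x. norm (f x) \<le> C" by (auto simp: bounded_iff)
  then have "(\<lambda>n. LINT x|measure_pmf (fconv n). f x) \<longlonglongrightarrow> (LINT x|law. f x)"
    using f by (intro fconv_tendsto)
  moreover have "(\<lambda>n. LINT x|measure_pmf (fconv n). f x) \<longlonglongrightarrow> (LINT x|\<mu>. f x)"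
    using assms(3) f by (simp add: weak_conv_def)
  ultimately show "integral\<^sup>L \<mu> f = integral\<^sup>L law f" by (rule LIMSEQ_unique[rotated])
qed (use assms in \<open>auto intro: prob_space.finite_measure law.finite_measure_axioms\<close>)

end

subsection \<open>A uniform lower bound for the transforms\<close>

text \<open>Sequential compactness of the space of sequences over \<open>A\<close>: pigeonhole
  refines the subsequence in each coordinate and a diagonal sequence is taken. It follows the
  refinement for coordinate k only from index \<open>Suc k\<close> on, hence the eventual
  equality.\<close>

lemma finite_alphabet_subsequence:
  fixes S :: "nat \<Rightarrow> nat \<Rightarrow> 'a"
  assumes "finite A" and S: "\<And>j k. S j k \<in> A"
  obtains r t where "strict_mono r" "\<And>k. t k \<in> A" "\<And>k. \<forall>\<^sub>F j in sequentially. S (r j) k = t k"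
proof -
  interpret subseqs "\<lambda>n r. \<exists>a. \<forall>j. S (r j) n = a"
  proof
    fix n and s :: "nat \<Rightarrow> nat"
    have "finite (range (\<lambda>j. S (s j) n))"
      using \<open>finite A\<close> S by (auto intro: finite_subset)
    then obtain i where "infinite {j \<in> UNIV. S (s j) n = S (s i) n}"
      using pigeonhole_infinite[of UNIV "\<lambda>j. S (s j) n"] by auto
    then obtain r' :: "nat \<Rightarrow> nat" where "strict_mono r'" "\<And>j. r' j \<in> {j \<in> UNIV. S (s j) n = S (s i) n}"
      using infinite_enumerate by blast
    then show "\<exists>r' :: nat \<Rightarrow> nat. strict_mono r' \<and> (\<exists>a. \<forall>j. S ((s \<circ> r') j) n = a)"
      by (intro exI[of _ r'] conjI exI[of _ "S (s i) n"]) auto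
  qed
  have "\<exists>a. \<forall>j. S ((diagseq \<circ> ((+) (Suc k))) j) k = a" for k
    by (rule diagseq_holds) auto
  then obtain t where t: "\<And>k j. S (diagseq (Suc k + j)) k = t k"
    unfolding o_def by metis
  show ?thesis
  proof
    show "strict_mono diagseq" by (rule subseq_diagseq)
    show "t k \<in> A" for k using t[of k 0] S by metis
    show "\<forall>\<^sub>F j in sequentially. S (diagseq j) k = t k" for k
    proof (rule eventually_sequentiallyI)
      show "S (diagseq j) k = t k" if "Suc k \<le> j" for j
        using t[of k "j - Suc k"] that by simp
    qed
  qed
qed

context digit_sequence
begin

lemma norm_partial_ft_le: "norm (partial_ft n \<xi>) \<le> 1"
  using integral_norm_bound[of "measure_pmf (fconv n)" "expo \<xi>"] by (simp add: integral_expo_fconv)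

lemma partial_ft_cong:
  assumes "digit_sequence t" and "\<And>k. k < n \<Longrightarrow> s k = t k"
  shows "partial_ft n \<xi> = digit_sequence.partial_ft t n \<xi>"
proof -
  interpret t: digit_sequence t by fact
  have "scale_prod s (Suc k) = scale_prod t (Suc k)" if "k < n" for k
    using assms(2) that unfolding scale_prod_def by (intro ext prod.cong) auto
  then show ?thesis
    using assms(2) unfolding partial_ft_def t.partial_ft_def by (intro prod.cong) auto
qed

text \<open>A common beginning gives the same \<open>partial_ft n\<close> and the same
  \<open>p n\<close>. Both tails have transform 1 at 0 and are Lipschitz, evaluated at a point
  shrunk by \<open>2 ^ n\<close>; their two constants \<open>2 * pi\<close> add up to
  \<open>4 * pi\<close>.\<close>

lemma ft_diff_le:
  assumes t: "digit_sequence t" and eq: "\<And>k. k < n \<Longrightarrow> s k = t k"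
  shows "norm (ft \<xi> - digit_sequence.ft t \<xi>) \<le> 4 * pi * CARD('d) * norm \<xi> / 2 ^ n"
proof -
  interpret t: digit_sequence t by fact
  interpret T: digit_sequence "\<lambda>j. s (n + j)" by (rule digit_sequence_shift) unfold_locales
  interpret T': digit_sequence "\<lambda>j. t (n + j)" by (rule digit_sequence_shift[OF t])
  let ?v = "vdiv \<xi> (p n)"
  have p: "scale_prod t n = p n"
    using eq unfolding scale_prod_def by (intro ext prod.cong) auto
  have "ft \<xi> - t.ft \<xi> = partial_ft n \<xi> * (T.ft ?v - T'.ft ?v)"
    using ft_shift[of \<xi> n] t.ft_shift[of \<xi> n] partial_ft_cong[OF t eq] p by (simp add: algebra_simps)
  then have "norm (ft \<xi> - t.ft \<xi>) \<le> norm (T.ft ?v - T'.ft ?v)"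
    using norm_partial_ft_le[of n \<xi>] by (simp add: norm_mult mult_left_le_one_le)
  also have "\<dots> \<le> norm (T.ft ?v - T.ft 0) + norm (T'.ft ?v - T'.ft 0)"
    using norm_triangle_ineq4[of "T.ft ?v - T.ft 0" "T'.ft ?v - T'.ft 0"] by simp
  also have "\<dots> \<le> 4 * pi * CARD('d) * norm ?v"
    using T.ft_lipschitz[of ?v 0] T'.ft_lipschitz[of ?v 0] by simp
  also have "\<dots> \<le> 4 * pi * CARD('d) * (norm \<xi> / 2 ^ n)"
    using norm_vdiv_le by (intro mult_left_mono) auto
  finally show ?thesis by simp
qed

end

lemma in_D_digit_sequence:
  assumes "\<forall>(m, B)\<in>A. in_D m B" "range s \<subseteq> A"
  shows "digit_sequence s"
proof
  have "s k \<in> A" for k using assms by auto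
  then show "in_D_seq s" using assms(1) by (fastforce simp: in_D_seq_def)
qed

text \<open>Joint continuity in the sequence and the point: the Lipschitz bound, uniform over
  sequences, controls the point, and agreement on long beginnings controls the sequence.\<close>

lemma ft_tendsto:
  assumes s: "\<And>j. digit_sequence (s j)" and t: "digit_sequence t"
    and lim: "\<And>k. \<forall>\<^sub>F j in sequentially. s j k = t k" and x: "x \<longlonglongrightarrow> l"
  shows "(\<lambda>j. digit_sequence.ft (s j) (x j)) \<longlonglongrightarrow> digit_sequence.ft t (l :: real^'d::finite)"
proof -
  let ?L = "4 * pi * CARD('d)"
  have A: "(\<lambda>j. digit_sequence.ft (s j) (x j) - digit_sequence.ft (s j) l) \<longlonglongrightarrow> 0"
  proof (rule Lim_null_comparison)
    show "\<forall>\<^sub>F j in sequentially. norm (digit_sequence.ft (s j) (x j) - digit_sequence.ft (s j) l)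
        \<le> 2 * pi * CARD('d) * norm (x j - l)"
      using digit_sequence.ft_lipschitz[OF s] by (intro always_eventually allI)
    have "(\<lambda>j. norm (x j - l)) \<longlonglongrightarrow> 0" using x by (simp add: LIM_zero tendsto_norm_zero)
    then show "(\<lambda>j. 2 * pi * CARD('d) * norm (x j - l)) \<longlonglongrightarrow> 0"
      by (rule tendsto_mult_right_zero)
  qed
  have B: "(\<lambda>j. digit_sequence.ft (s j) l - digit_sequence.ft t l) \<longlonglongrightarrow> 0"
    unfolding tendsto_iff
  proof (intro allI impI)
    fix e :: real assume "0 < e"
    have "(\<lambda>n. ?L * norm l * (1 / 2) ^ n) \<longlonglongrightarrow> 0"
      by (intro tendsto_mult_right_zero LIMSEQ_realpow_zero) auto
    then have "\<forall>\<^sub>F n in sequentially. ?L * norm l * (1 / 2) ^ n < e"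
      using \<open>0 < e\<close> by (rule order_tendstoD)
    then obtain n where n: "?L * norm l * (1 / 2) ^ n < e"
      by (auto simp: eventually_sequentially)
    have "\<forall>\<^sub>F j in sequentially. \<forall>k\<in>{..<n}. s j k = t k"
      using lim by (intro eventually_ball_finite) auto
    then show "\<forall>\<^sub>F j in sequentially. dist (digit_sequence.ft (s j) l - digit_sequence.ft t l) 0 < e"
    proof eventually_elim
      case (elim j)
      have "norm (digit_sequence.ft (s j) l - digit_sequence.ft t l) \<le> ?L * norm l / 2 ^ n"
        using elim by (intro digit_sequence.ft_diff_le[OF s t]) auto
      then show ?case using n by (simp add: power_divide)
    qed
  qed
  have "(\<lambda>j. (digit_sequence.ft (s j) (x j) - digit_sequence.ft (s j) l)
      + (digit_sequence.ft (s j) l - digit_sequence.ft t l)) \<longlonglongrightarrow> 0 + 0"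
    by (rule tendsto_add[OF A B])
  then show ?thesis by (simp add: LIM_zero_iff)
qed

text \<open>Compactness: counterexamples with bounds tending to 0 would lead to a limit sequence
  over \<open>A\<close> and a limit point whose whole lattice translate consists of zeros, contrary
  to \<open>ft_nonzero_translate\<close>.\<close>

lemma ft_lower_bound:
  fixes A :: "(('d::finite \<Rightarrow> int) \<times> (real^'d) set) set"
  assumes fin: "finite A" and D: "\<forall>(m, B)\<in>A. in_D m B"
  shows "\<exists>e>0. \<forall>s x. range s \<subseteq> A \<longrightarrow> (\<exists>k\<in>int_lattice. e \<le> norm (digit_sequence.ft s (x + k)))"
proof (rule ccontr)
  assume neg: "\<not> ?thesis"
  have "\<exists>s x. range s \<subseteq> A \<and> (\<forall>k\<in>int_lattice. norm (digit_sequence.ft s (x + k)) < 1 / Suc j)" for j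
  proof -
    have "0 < 1 / real (Suc j)" by simp
    then show ?thesis using neg by (meson not_less)
  qed
  then obtain S X where S: "\<And>j. range (S j) \<subseteq> A"
    and X: "\<And>j k. k \<in> int_lattice \<Longrightarrow> norm (digit_sequence.ft (S j) (X j + k)) < 1 / Suc j"
    by metis
  \<comment> \<open>An integer translation only reindexes the vectors \<open>k\<close>, so the
    points may be moved into the compact unit cube.\<close>
  define Y where "Y j = (\<chi> i. frac (X j $ i))" for j
  have Y: "norm (digit_sequence.ft (S j) (Y j + k)) < 1 / Suc j" if "k \<in> int_lattice" for j k
  proof -
    define f :: "real^'d" where "f = (\<chi> i. of_int \<lfloor>X j $ i\<rfloor>)"
    have "f \<in> int_lattice" by (simp add: f_def int_lattice_def)
    moreover have "Y j + k = X j + (k - f)" by (simp add: Y_def f_def vec_eq_iff frac_def)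
    ultimately show ?thesis
      using X[OF int_lattice_diff[OF that], of f j] by (simp only:)
  qed
  have "\<forall>j. Y j \<in> cbox 0 1"
    by (simp add: Y_def mem_box_cart frac_ge_0 less_imp_le[OF frac_lt_1])
  then obtain l r1 where r1: "strict_mono r1" "(Y \<circ> r1) \<longlonglongrightarrow> l"
    using compact_imp_seq_compact[OF compact_cbox[of "0::real^'d" 1]] unfolding seq_compact_def by metis
  obtain r t where r: "strict_mono r" and t: "\<And>k. t k \<in> A"
    and lim: "\<And>k. \<forall>\<^sub>F j in sequentially. S (r1 (r j)) k = t k"
    using finite_alphabet_subsequence[OF fin, of "\<lambda>j. S (r1 j)"] S by blast
  have t': "digit_sequence t" using t by (intro in_D_digit_sequence[OF D]) auto
  interpret t: digit_sequence t by (rule t')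
  have "card (snd (t k)) \<le> Max ((\<lambda>a. card (snd a)) ` A)" for k
    using fin t by (intro Max_ge) auto
  then obtain k where k: "k \<in> int_lattice" "t.ft (l + k) \<noteq> 0"
    using t.ft_nonzero_translate by blast
  have "(\<lambda>j. Y (r1 (r j)) + k) \<longlonglongrightarrow> l + k"
    using LIMSEQ_subseq_LIMSEQ[OF r1(2) r] by (intro tendsto_intros) (simp add: o_def)
  then have A: "(\<lambda>j. digit_sequence.ft (S (r1 (r j))) (Y (r1 (r j)) + k)) \<longlonglongrightarrow> t.ft (l + k)"
    using lim by (intro ft_tendsto in_D_digit_sequence[OF D S] t')
  have "(\<lambda>j. digit_sequence.ft (S (r1 (r j))) (Y (r1 (r j)) + k)) \<longlonglongrightarrow> 0"
  proof (rule Lim_null_comparison)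
    show "(\<lambda>j. inverse (real (Suc j))) \<longlonglongrightarrow> 0" by (rule LIMSEQ_inverse_real_of_nat)
    show "\<forall>\<^sub>F j in sequentially. norm (digit_sequence.ft (S (r1 (r j))) (Y (r1 (r j)) + k))
        \<le> inverse (real (Suc j))"
    proof (intro always_eventually allI)
      fix j
      have "j \<le> r1 (r j)"
        using seq_suble[OF r, of j] seq_suble[OF r1(1), of "r j"] by linarith
      then have "1 / real (Suc (r1 (r j))) \<le> 1 / real (Suc j)" by (simp add: field_simps)
      then show "norm (digit_sequence.ft (S (r1 (r j))) (Y (r1 (r j)) + k)) \<le> inverse (real (Suc j))"
        using Y[OF k(1), of "r1 (r j)"] by (simp add: inverse_eq_divide)
    qed
  qed
  then show False using LIMSEQ_unique[OF A] k by blast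
qed

text \<open>The Lipschitz bound spreads the lower bound to a ball. The clause
  \<open>x = 0 \<longrightarrow> k = 0\<close>, possible as the transform is 1 at 0, later keeps 0
  fixed and thereby makes the spectra nested.\<close>

lemma ft_equi_positive:
  fixes A :: "(('d::finite \<Rightarrow> int) \<times> (real^'d) set) set"
  assumes fin: "finite A" and D: "\<forall>(m, B)\<in>A. in_D m B"
  obtains e \<delta> where "0 < e" "0 < \<delta>"
    and "\<And>s x. range s \<subseteq> A \<Longrightarrow> \<exists>k\<in>int_lattice. (x = 0 \<longrightarrow> k = 0) \<and>
      (\<forall>y. norm y < \<delta> \<longrightarrow> e \<le> norm (digit_sequence.ft s (x + k + y)))"
proof -
  obtain c where c: "0 < c" "\<And>s x. range s \<subseteq> A \<Longrightarrow> \<exists>k\<in>int_lattice. c \<le> norm (digit_sequence.ft s (x + k))"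
    using ft_lower_bound[OF fin D] by blast
  \<comment> \<open>\<open>2 * e\<close> is at most \<open>c\<close> and at most the value 1 at 0;
    half of it is given up to the variation over the ball of radius \<open>e / L\<close>.\<close>
  define e where "e = min c 1 / 2"
  define L where "L = 2 * pi * CARD('d)"
  have pos: "0 < e" "0 < L" using c by (auto simp: e_def L_def)
  show ?thesis
  proof (rule that)
    show "0 < e" "0 < e / L" using pos by auto
    fix s :: "'d digit_seq" and x :: "real^'d" assume s: "range s \<subseteq> A"
    interpret digit_sequence s using D s by (rule in_D_digit_sequence)
    have "\<exists>k\<in>int_lattice. (x = 0 \<longrightarrow> k = 0) \<and> 2 * e \<le> norm (ft (x + k))"
    proof (cases "x = 0")
      case True
      then show ?thesis by (intro bexI[of _ 0]) (auto simp: e_def)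
    next
      case False
      have "2 * e \<le> c" by (simp add: e_def)
      then show ?thesis using c(2)[OF s, of x] False by (meson order_trans)
    qed
    then obtain k where k: "k \<in> int_lattice" "x = 0 \<longrightarrow> k = 0" "2 * e \<le> norm (ft (x + k))" by blast
    have "e \<le> norm (ft (x + k + y))" if "norm y < e / L" for y
    proof -
      have "norm (ft (x + k) - ft (x + k + y)) \<le> L * norm y"
        using ft_lipschitz[of "x + k" "x + k + y"] by (simp add: L_def)
      also have "\<dots> < e" using that pos by (simp add: field_simps)
      finally show ?thesis using k(3) norm_triangle_ineq2[of "ft (x + k)" "ft (x + k + y)"] by linarith
    qed
    then show "\<exists>k\<in>int_lattice. (x = 0 \<longrightarrow> k = 0) \<and> (\<forall>y. norm y < e / L \<longrightarrow> e \<le> norm (ft (x + k + y)))"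
      using k by blast
  qed
qed

subsection \<open>Finite spectra\<close>

definition vmul :: "real^'d::finite \<Rightarrow> ('d \<Rightarrow> real) \<Rightarrow> real^'d" where
  "vmul x p = (\<chi> i. x $ i * p i)"

lemma vmul_nth [simp]: "vmul x p $ i = x $ i * p i"
  by (simp add: vmul_def)

lemma vmul_zero [simp]: "vmul 0 p = 0"
  by (simp add: vec_eq_iff)

text \<open>By Parseval, for a finitely supported probability measure with Fourier transform \<^term>\<open>F\<close> this says
  that \<^term>\<open>\<Lambda>\<close> is a spectrum contained in the integer lattice.\<close>
definition fin_spectrum :: "(real^'d \<Rightarrow> complex) \<Rightarrow> (real^'d) set \<Rightarrow> bool" where
  "fin_spectrum F \<Lambda> \<longleftrightarrow> finite \<Lambda> \<and> \<Lambda> \<subseteq> int_lattice \<and> (\<forall>\<xi>. (\<Sum>l\<in>\<Lambda>. (norm (F (\<xi> + l)))\<^sup>2) = 1)"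

text \<open>At the point \<open>- l'\<close> the summand of \<open>l'\<close> is already 1, which
  forces all others to vanish.\<close>

lemma fin_spectrum_zero:
  assumes "fin_spectrum F \<Lambda>" "F 0 = 1" "l \<in> \<Lambda>" "l' \<in> \<Lambda>" "l \<noteq> l'"
  shows "F (l - l') = 0"
proof -
  have fin: "finite \<Lambda>" and sum: "(\<Sum>l\<in>\<Lambda>. (norm (F (- l' + l)))\<^sup>2) = 1"
    using assms(1) unfolding fin_spectrum_def by blast+
  have "(\<Sum>l\<in>\<Lambda>. (norm (F (- l' + l)))\<^sup>2) = 1 + (\<Sum>l\<in>\<Lambda> - {l'}. (norm (F (- l' + l)))\<^sup>2)"
    using fin assms by (subst sum.remove[of _ l']) auto
  then have "(\<Sum>l\<in>\<Lambda> - {l'}. (norm (F (- l' + l)))\<^sup>2) = 0" using sum by simp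
  then have "\<forall>l\<in>\<Lambda> - {l'}. (norm (F (- l' + l)))\<^sup>2 = 0"
    using fin by (subst (asm) sum_nonneg_eq_0_iff) auto
  then show ?thesis using assms by auto
qed

text \<open>A repetition in the family would contribute two summands 1 at the point \<^term>\<open>- g i\<close>.\<close>
lemma fin_spectrum_image:
  assumes "F 0 = 1" and fin: "finite I" and g: "g ` I \<subseteq> int_lattice"
    and sum: "\<And>\<xi>. (\<Sum>i\<in>I. (norm (F (\<xi> + g i)))\<^sup>2) = 1"
  shows "fin_spectrum F (g ` I)"
proof -
  have "inj_on g I"
  proof (rule inj_onI, rule ccontr)
    fix i j assume ij: "i \<in> I" "j \<in> I" "g i = g j" "i \<noteq> j"
    have "(\<Sum>k\<in>{i, j}. (norm (F (- g i + g k)))\<^sup>2) \<le> (\<Sum>k\<in>I. (norm (F (- g i + g k)))\<^sup>2)"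
      using fin ij by (intro sum_mono2) auto
    then show False using sum[of "- g i"] ij assms(1) by simp
  qed
  then show ?thesis
    using assms by (simp add: fin_spectrum_def sum.reindex)
qed

text \<open>Row orthogonality of the unitary matrix is Parseval for the uniform measure on the
  digits. Having 0 in \<open>L\<close> will keep earlier spectra inside later ones.\<close>

lemma admissible_spectrum:
  fixes m :: "'d::finite \<Rightarrow> int"
  assumes D: "in_D m B" and adm: "admissible (diag_mat m) B"
  obtains L where "finite L" "L \<subseteq> int_lattice" "0 \<in> L"
    "\<And>\<xi>. (\<Sum>l\<in>L. (norm ((\<Sum>b\<in>B. expo (vdiv (\<xi> + l) (\<lambda>i. real_of_int (m i))) b) / of_nat (card B)))\<^sup>2) = 1"
proof -
  let ?m = "\<lambda>i. real_of_int (m i)"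
  let ?n = "card B"
  have finB: "finite B" using D by (rule in_D_finite)
  have n: "?n > 0" using D finB by (auto simp: in_D_def card_gt_0_iff)
  have m0: "?m i \<noteq> 0" for i
  proof -
    have "2 \<le> m i" using D by (auto simp: in_D_def)
    then show ?thesis by simp
  qed
  obtain L where L: "finite L" "L \<subseteq> int_lattice" "card L = ?n"
    and U: "unitary_on B L (\<lambda>b l. exp (- 2 * pi * \<i> * complex_of_real ((matrix_inv (diag_mat m) *v b) \<bullet> l))
                            / complex_of_real (sqrt (real (card B))))"
    using adm by (auto simp: admissible_def)
  define E where "E b l = expo (vdiv l ?m) b" for b l
  \<comment> \<open>The exponent in \<open>admissible\<close> has the opposite sign, so the matrix
    entries are conjugates of \<open>E b l\<close>, up to normalisation.\<close>
  have Ueq: "exp (- 2 * pi * \<i> * complex_of_real ((matrix_inv (diag_mat m) *v b) \<bullet> l)) = cnj (E b l)" for b l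
  proof -
    have "matrix_inv (diag_mat m) *v b = vdiv b ?m"
      unfolding diag_mat_eq by (rule matrix_inv_diag) (rule m0)
    moreover have "cnj (E b l) = expo (- vdiv l ?m) b" by (simp add: E_def cnj_expo)
    ultimately show ?thesis
      by (simp add: expo_def inner_vdiv inner_commute[of l])
  qed
  have orth: "(\<Sum>l\<in>L. E b l * cnj (E b' l)) = (if b = b' then of_nat ?n else 0)" if "b \<in> B" "b' \<in> B" for b b'
  proof -
    let ?c = "complex_of_real (sqrt (real ?n))"
    have c: "?c * ?c = of_nat ?n" by (simp flip: of_real_mult)
    have "(\<Sum>l\<in>L. cnj (E b' l) / ?c * cnj (cnj (E b l) / ?c)) = (if b' = b then 1 else 0)"
      using U that unfolding unitary_on_def Ueq by blast
    moreover have "(\<Sum>l\<in>L. cnj (E b' l) / ?c * cnj (cnj (E b l) / ?c))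
        = (\<Sum>l\<in>L. E b l * cnj (E b' l)) / of_nat ?n"
      by (simp add: c sum_divide_distrib mult.commute)
    ultimately show ?thesis using n by (auto simp: field_simps split: if_splits)
  qed
  have sum: "(\<Sum>l\<in>L. (norm ((\<Sum>b\<in>B. expo (vdiv (\<xi> + l) ?m) b) / of_nat ?n))\<^sup>2) = 1" for \<xi>
  proof -
    define z where "z b = expo (vdiv \<xi> ?m) b" for b
    \<comment> \<open>Expanding the square and summing over \<open>l\<close> first leaves the
      diagonal terms \<open>z b * cnj (z b) = 1\<close>, each with weight \<open>?n\<close>.\<close>
    have "complex_of_real (\<Sum>l\<in>L. (norm (\<Sum>b\<in>B. z b * E b l))\<^sup>2)
        = (\<Sum>l\<in>L. (\<Sum>b\<in>B. z b * E b l) * (\<Sum>b\<in>B. cnj (z b) * cnj (E b l)))"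
      by (simp only: of_real_sum complex_norm_square cnj_sum complex_cnj_mult)
    also have "\<dots> = (\<Sum>l\<in>L. \<Sum>b\<in>B. \<Sum>b'\<in>B. z b * cnj (z b') * (E b l * cnj (E b' l)))"
      by (simp add: sum_product mult_ac)
    also have "\<dots> = (\<Sum>b\<in>B. \<Sum>b'\<in>B. z b * cnj (z b') * (\<Sum>l\<in>L. E b l * cnj (E b' l)))"
      by (subst sum.swap, rule sum.cong[OF refl], subst sum.swap) (simp add: sum_distrib_left)
    also have "\<dots> = (\<Sum>b\<in>B. \<Sum>b'\<in>B. if b = b' then z b * cnj (z b') * of_nat ?n else 0)"
      by (intro sum.cong refl) (simp add: orth)
    also have "\<dots> = (\<Sum>b\<in>B. of_nat ?n)"
      using finB by (simp add: z_def flip: complex_norm_square)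
    also have "\<dots> = complex_of_real ((real ?n)\<^sup>2)" by (simp add: power2_eq_square)
    finally have eq: "(\<Sum>l\<in>L. (norm (\<Sum>b\<in>B. z b * E b l))\<^sup>2) = (real ?n)\<^sup>2"
      unfolding of_real_eq_iff .
    have "(\<Sum>l\<in>L. (norm ((\<Sum>b\<in>B. expo (vdiv (\<xi> + l) ?m) b) / of_nat ?n))\<^sup>2)
        = (\<Sum>l\<in>L. (norm (\<Sum>b\<in>B. z b * E b l))\<^sup>2) / (real ?n)\<^sup>2"
      by (simp add: z_def E_def vdiv_add expo_add norm_divide power_divide flip: sum_divide_distrib)
    then show ?thesis using eq n by simp
  qed
  \<comment> \<open>The identity holds at every \<open>\<xi>\<close>, so \<open>L\<close> may be
    translated to contain 0.\<close>
  have "L \<noteq> {}" using L n by auto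
  then obtain l0 where l0: "l0 \<in> L" by blast
  show ?thesis
  proof (rule that)
    show "finite ((\<lambda>l. l - l0) ` L)" "0 \<in> (\<lambda>l. l - l0) ` L" using L l0 by auto
    show "(\<lambda>l. l - l0) ` L \<subseteq> int_lattice" using L l0 by auto
    have inj: "inj_on (\<lambda>l. l - l0) L" by (simp add: inj_on_def)
    show "(\<Sum>l\<in>(\<lambda>l. l - l0) ` L. (norm ((\<Sum>b\<in>B. expo (vdiv (\<xi> + l) ?m) b) / of_nat ?n))\<^sup>2) = 1" for \<xi>
      using sum[of "\<xi> - l0"] by (simp add: sum.reindex[OF inj] algebra_simps)
  qed
qed

context digit_sequence
begin

lemma base_integer: "p n i \<in> \<int>"
  unfolding scale_prod_def by (intro Ints_prod) auto

lemma vmul_int_lattice: "k \<in> int_lattice \<Longrightarrow> vmul k (p n) \<in> int_lattice"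
  by (simp add: int_lattice_def base_integer)

lemma vdiv_vmul [simp]: "vdiv (vmul k (p n)) (p n) = k"
  by (simp add: vec_eq_iff)

lemma digits_int_lattice: "b \<in> snd (s k) \<Longrightarrow> b \<in> int_lattice"
  using in_D_nth[of k] by (auto simp: in_D_def int_lattice_def)

lemma partial_ft_zero: "partial_ft n 0 = 1"
  by (simp add: partial_ft_def)

text \<open>For \<open>j < n\<close> the product \<open>p (Suc j)\<close> divides
  \<open>p n\<close>, so the translation multiplies each exponential by a character that is 1 on
  integer digits.\<close>

lemma partial_ft_periodic:
  assumes k: "k \<in> int_lattice"
  shows "partial_ft n (\<xi> + vmul k (p n)) = partial_ft n \<xi>"
  unfolding partial_ft_def
proof (intro prod.cong refl arg_cong2[of _ _ _ _ "(/)"] sum.cong)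
  fix j b assume j: "j \<in> {..<n}" and b: "b \<in> snd (s j)"
  interpret T: digit_sequence "\<lambda>i. s (Suc j + i)" by (rule digit_sequence_shift) unfold_locales
  have "p n i = p (Suc j) i * T.p (n - Suc j) i" for i
    using scale_prod_add[of s "Suc j" "n - Suc j" i] j by simp
  then have "vdiv (vmul k (p n)) (p (Suc j)) = vmul k (T.p (n - Suc j))"
    by (simp add: vec_eq_iff)
  then have "expo (vdiv (vmul k (p n)) (p (Suc j))) b = 1"
    using T.vmul_int_lattice[OF k] digits_int_lattice[OF b] by (simp add: expo_int_lattice)
  then show "expo (vdiv (\<xi> + vmul k (p n)) (p (Suc j))) b = expo (vdiv \<xi> (p (Suc j))) b"
    by (simp add: vdiv_add expo_add)
qed

lemma fin_spectrum_shift: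
  assumes \<Lambda>: "fin_spectrum (partial_ft n) \<Lambda>" and \<kappa>: "\<And>l. l \<in> \<Lambda> \<Longrightarrow> \<kappa> l \<in> int_lattice"
  shows "fin_spectrum (partial_ft n) ((\<lambda>l. l + vmul (\<kappa> l) (p n)) ` \<Lambda>)"
proof (rule fin_spectrum_image)
  show "finite \<Lambda>" using \<Lambda> by (simp add: fin_spectrum_def)
  show "(\<lambda>l. l + vmul (\<kappa> l) (p n)) ` \<Lambda> \<subseteq> int_lattice"
    using \<Lambda> \<kappa> vmul_int_lattice by (auto simp: fin_spectrum_def)
  show "(\<Sum>l\<in>\<Lambda>. (norm (partial_ft n (\<xi> + (l + vmul (\<kappa> l) (p n)))))\<^sup>2) = 1" for \<xi>
    using \<Lambda> \<kappa> by (simp add: partial_ft_periodic fin_spectrum_def flip: add.assoc)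
qed (rule partial_ft_zero)

text \<open>Sum over \<open>l'\<close> first: the level-n factor is periodic, hence free of
  \<open>l'\<close>, and the spectrum of \<open>F\<close> gives 1 at the rescaled point. A general
  \<open>F\<close> covers both a single further pair and a block of pairs.\<close>

lemma fin_spectrum_compose:
  assumes \<Lambda>: "fin_spectrum (partial_ft n) \<Lambda>" and \<Lambda>': "fin_spectrum F \<Lambda>'"
    and H: "\<And>\<xi>. H \<xi> = partial_ft n \<xi> * F (vdiv \<xi> (p n))" and H0: "H 0 = 1"
  shows "fin_spectrum H ((\<lambda>(l, l'). l + vmul l' (p n)) ` (\<Lambda> \<times> \<Lambda>'))"
proof (rule fin_spectrum_image)
  have fin: "finite \<Lambda>" "finite \<Lambda>'" "\<Lambda> \<subseteq> int_lattice" "\<Lambda>' \<subseteq> int_lattice"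
    using \<Lambda> \<Lambda>' by (auto simp: fin_spectrum_def)
  show "finite (\<Lambda> \<times> \<Lambda>')" using fin by simp
  show "(\<lambda>(l, l'). l + vmul l' (p n)) ` (\<Lambda> \<times> \<Lambda>') \<subseteq> int_lattice"
    using fin vmul_int_lattice by (auto simp: subset_iff)
  fix \<xi>
  have "(\<Sum>i\<in>\<Lambda> \<times> \<Lambda>'. (norm (H (\<xi> + (case i of (l, l') \<Rightarrow> l + vmul l' (p n)))))\<^sup>2)
      = (\<Sum>l\<in>\<Lambda>. \<Sum>l'\<in>\<Lambda>'. (norm (H (\<xi> + l + vmul l' (p n))))\<^sup>2)"
    by (simp add: sum.cartesian_product add.assoc case_prod_beta)
  also have "\<dots> = (\<Sum>l\<in>\<Lambda>. \<Sum>l'\<in>\<Lambda>'. (norm (partial_ft n (\<xi> + l)))\<^sup>2 * (norm (F (vdiv (\<xi> + l) (p n) + l')))\<^sup>2)"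
  proof (intro sum.cong refl)
    fix l l' assume "l \<in> \<Lambda>" "l' \<in> \<Lambda>'"
    then have "l' \<in> int_lattice" using fin by auto
    then show "(norm (H (\<xi> + l + vmul l' (p n))))\<^sup>2
        = (norm (partial_ft n (\<xi> + l)))\<^sup>2 * (norm (F (vdiv (\<xi> + l) (p n) + l')))\<^sup>2"
      unfolding H by (simp add: partial_ft_periodic vdiv_add norm_mult power_mult_distrib)
  qed
  also have "\<dots> = (\<Sum>l\<in>\<Lambda>. (norm (partial_ft n (\<xi> + l)))\<^sup>2)"
    using \<Lambda>' by (simp add: fin_spectrum_def flip: sum_distrib_left)
  also have "\<dots> = 1" using \<Lambda> by (simp add: fin_spectrum_def)
  finally show "(\<Sum>i\<in>\<Lambda> \<times> \<Lambda>'. (norm (H (\<xi> + (case i of (l, l') \<Rightarrow> l + vmul l' (p n)))))\<^sup>2) = 1" .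
qed (rule H0)

lemma ex_fin_spectrum:
  assumes adm: "\<And>k. admissible (diag_mat (fst (s k))) (snd (s k))"
  shows "\<exists>\<Lambda>. fin_spectrum (partial_ft n) \<Lambda> \<and> 0 \<in> \<Lambda>"
proof (induction n)
  case 0
  show ?case by (rule exI[of _ "{0}"]) (simp add: fin_spectrum_def)
next
  case (Suc n)
  then obtain \<Lambda> where \<Lambda>: "fin_spectrum (partial_ft n) \<Lambda>" "0 \<in> \<Lambda>" by blast
  let ?F = "\<lambda>\<xi>. (\<Sum>b\<in>snd (s n). expo (vdiv \<xi> (\<lambda>i. real_of_int (fst (s n) i))) b) / of_nat (card (snd (s n)))"
  obtain L where L: "finite L" "L \<subseteq> int_lattice" "0 \<in> L" "\<And>\<xi>. (\<Sum>l\<in>L. (norm (?F (\<xi> + l)))\<^sup>2) = 1"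
    using admissible_spectrum[OF in_D_nth adm] by blast
  have "fin_spectrum (partial_ft (Suc n)) ((\<lambda>(l, l'). l + vmul l' (p n)) ` (\<Lambda> \<times> L))"
  proof (rule fin_spectrum_compose[OF \<Lambda>(1)])
    show "fin_spectrum ?F L" using L by (simp add: fin_spectrum_def)
    have "vdiv \<xi> (p (Suc n)) = vdiv (vdiv \<xi> (p n)) (\<lambda>i. real_of_int (fst (s n) i))" for \<xi>
      by (simp add: vec_eq_iff scale_prod_Suc)
    then show "partial_ft (Suc n) \<xi> = partial_ft n \<xi> * ?F (vdiv \<xi> (p n))" for \<xi>
      by (simp add: partial_ft_Suc)
  qed (rule partial_ft_zero)
  moreover have "0 \<in> (\<lambda>(l, l'). l + vmul l' (p n)) ` (\<Lambda> \<times> L)"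
    using \<Lambda>(2) L(3) by (auto intro!: image_eqI[of _ _ "(0, 0)"])
  ultimately show ?case by blast
qed

text \<open>A finite spectrum at level \<^term>\<open>n\<close> is good if replacing the full transform by the partial one
  loses at most the factor \<^term>\<open>e\<close>, uniformly near its points.\<close>
definition good_level :: "real \<Rightarrow> real \<Rightarrow> nat \<times> (real^'d) set \<Rightarrow> bool" where
  "good_level e \<delta> a \<longleftrightarrow> (case a of (n, \<Lambda>) \<Rightarrow> fin_spectrum (partial_ft n) \<Lambda> \<and>
     (\<forall>l\<in>\<Lambda>. \<forall>y. norm y < \<delta> / 2 \<longrightarrow> e \<le> norm (digit_sequence.ft (\<lambda>j. s (n + j)) (vdiv l (p n) + y))))"

text \<open>The new level is so deep that the old points become shorter than
  \<open>\<delta> / 2\<close> after rescaling. A rescaled new point is then a centre supplied by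
  \<open>equi\<close> up to such an error, and the remaining \<open>\<delta> / 2\<close> is the
  radius that \<open>good_level\<close> asks for.\<close>

lemma good_level_extend:
  assumes adm: "\<And>k. admissible (diag_mat (fst (s k))) (snd (s k))" and pos: "0 < \<delta>"
    and equi: "\<And>n x. \<exists>k\<in>int_lattice. (x = 0 \<longrightarrow> k = 0) \<and>
      (\<forall>y. norm y < \<delta> \<longrightarrow> e \<le> norm (digit_sequence.ft (\<lambda>j. s (n + j)) (x + k + y)))"
    and good: "good_level e \<delta> (n, \<Lambda>)"
  shows "\<exists>n' \<Lambda>'. good_level e \<delta> (n', \<Lambda>') \<and> n < n' \<and> \<Lambda> \<subseteq> \<Lambda>'"
proof -
  have \<Lambda>: "fin_spectrum (partial_ft n) \<Lambda>" using good by (simp add: good_level_def)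
  then have fin: "finite \<Lambda>" by (simp add: fin_spectrum_def)
  interpret T: digit_sequence "\<lambda>j. s (n + j)" by (rule digit_sequence_shift) unfold_locales
  have "(\<lambda>k. (\<Sum>l\<in>\<Lambda>. norm l) * (1 / 2) ^ k) \<longlonglongrightarrow> 0"
    by (intro tendsto_mult_right_zero LIMSEQ_realpow_zero) auto
  then have "\<forall>\<^sub>F k in sequentially. (\<Sum>l\<in>\<Lambda>. norm l) * (1 / 2) ^ k < \<delta> / 2"
    using pos by (intro order_tendstoD) auto
  then obtain k0 where k0: "\<And>k. k \<ge> k0 \<Longrightarrow> (\<Sum>l\<in>\<Lambda>. norm l) * (1 / 2) ^ k < \<delta> / 2"
    by (auto simp: eventually_sequentially)
  define k where "k = Suc k0"
  have small: "norm (vdiv l (p (n + k))) < \<delta> / 2" if "l \<in> \<Lambda>" for l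
  proof -
    have "norm (vdiv l (p (n + k))) \<le> norm l * (1 / 2) ^ (n + k)"
      using norm_vdiv_le[of l "n + k"] by (simp add: power_divide)
    also have "\<dots> \<le> (\<Sum>l\<in>\<Lambda>. norm l) * (1 / 2) ^ (n + k)"
      using that fin by (intro mult_right_mono member_le_sum) auto
    also have "\<dots> < \<delta> / 2" by (rule k0) (simp add: k_def)
    finally show ?thesis .
  qed
  obtain \<Lambda>0 where \<Lambda>0: "fin_spectrum (T.partial_ft k) \<Lambda>0" "0 \<in> \<Lambda>0"
    using T.ex_fin_spectrum adm by blast
  \<comment> \<open>The translations come from \<open>equi\<close> for the tail after level
    \<open>n + k\<close>, at the rescaled points of the new block's spectrum.\<close>
  obtain \<kappa> where \<kappa>: "\<And>l. \<kappa> l \<in> int_lattice" "\<And>l. vdiv l (T.p k) = 0 \<Longrightarrow> \<kappa> l = 0"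
    "\<And>l y. norm y < \<delta> \<Longrightarrow> e \<le> norm (digit_sequence.ft (\<lambda>j. s (n + k + j)) (vdiv l (T.p k) + \<kappa> l + y))"
    using equi[of "vdiv _ (T.p k)" "n + k"] by metis
  define \<Lambda>1 where "\<Lambda>1 = (\<lambda>l. l + vmul (\<kappa> l) (T.p k)) ` \<Lambda>0"
  define \<Lambda>' where "\<Lambda>' = (\<lambda>(l, l'). l + vmul l' (p n)) ` (\<Lambda> \<times> \<Lambda>1)"
  have "fin_spectrum (T.partial_ft k) \<Lambda>1"
    unfolding \<Lambda>1_def using \<Lambda>0(1) \<kappa>(1) by (rule T.fin_spectrum_shift)
  then have spec: "fin_spectrum (partial_ft (n + k)) \<Lambda>'"
    unfolding \<Lambda>'_def using \<Lambda> partial_ft_add partial_ft_zero by (intro fin_spectrum_compose)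
  have "good_level e \<delta> (n + k, \<Lambda>')"
    unfolding good_level_def prod.case
  proof (intro conjI ballI allI impI)
    fix q y assume q: "q \<in> \<Lambda>'" and y: "norm (y :: real^'d) < \<delta> / 2"
    then obtain l l' where l: "l \<in> \<Lambda>" "l' \<in> \<Lambda>0" "q = l + vmul (l' + vmul (\<kappa> l') (T.p k)) (p n)"
      by (auto simp: \<Lambda>'_def \<Lambda>1_def)
    have "vdiv q (p (n + k)) = vdiv l (p (n + k)) + (vdiv l' (T.p k) + \<kappa> l')"
      unfolding l(3) vdiv_shift by (simp add: vec_eq_iff add_divide_distrib distrib_right)
    then have eq: "vdiv q (p (n + k)) + y = vdiv l' (T.p k) + \<kappa> l' + (vdiv l (p (n + k)) + y)" by simp
    have small': "norm (vdiv l (p (n + k)) + y) < \<delta>"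
      using norm_triangle_ineq[of "vdiv l (p (n + k))" y] small[OF l(1)] y by linarith
    show "e \<le> norm (digit_sequence.ft (\<lambda>j. s (n + k + j)) (vdiv q (p (n + k)) + y))"
      unfolding eq by (rule \<kappa>(3)[OF small'])
  qed (rule spec)
  moreover have "\<Lambda> \<subseteq> \<Lambda>'"
  proof
    fix l assume "l \<in> \<Lambda>"
    \<comment> \<open>The point 0 receives the translation 0, so it survives and every old
      \<open>l\<close> reappears as the pair \<open>(l, 0)\<close>.\<close>
    moreover have "0 \<in> \<Lambda>1"
      unfolding \<Lambda>1_def using \<Lambda>0(2) \<kappa>(2)[of 0] by (auto intro!: image_eqI[of _ _ 0])
    ultimately show "l \<in> \<Lambda>'" unfolding \<Lambda>'_def by (auto intro!: image_eqI[of _ _ "(l, 0)"])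
  qed
  ultimately show ?thesis by (intro exI[of _ "n + k"] exI[of _ \<Lambda>']) (auto simp: k_def)
qed

lemma ex_good_levels:
  assumes adm: "\<And>k. admissible (diag_mat (fst (s k))) (snd (s k))" and pos: "0 < \<delta>"
    and equi: "\<And>n x. \<exists>k\<in>int_lattice. (x = 0 \<longrightarrow> k = 0) \<and>
      (\<forall>y. norm y < \<delta> \<longrightarrow> e \<le> norm (digit_sequence.ft (\<lambda>j. s (n + j)) (x + k + y)))"
  obtains N \<Lambda> where "\<And>j. good_level e \<delta> (N j, \<Lambda> j)" "strict_mono N" "incseq \<Lambda>"
proof -
  have "good_level e \<delta> (0, {0})"
    using equi[of 0 0] pos by (auto simp: good_level_def fin_spectrum_def)
  then have "\<exists>a. good_level e \<delta> a" by blast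
  moreover have "\<exists>b. good_level e \<delta> b \<and> fst a < fst b \<and> snd a \<subseteq> snd b" if "good_level e \<delta> a" for a and j :: nat
    using good_level_extend[OF adm pos equi, of "fst a" "snd a"] that by force
  ultimately obtain a where a: "\<And>j. good_level e \<delta> (a j)"
    "\<And>j. fst (a j) < fst (a (Suc j)) \<and> snd (a j) \<subseteq> snd (a (Suc j))"
    using dependent_nat_choice[of "\<lambda>_. good_level e \<delta>" "\<lambda>_ a b. fst a < fst b \<and> snd a \<subseteq> snd b"] by metis
  show ?thesis
  proof
    show "good_level e \<delta> (fst (a j), snd (a j))" for j using a by simp
    show "strict_mono (\<lambda>j. fst (a j))" using a(2) by (simp add: strict_mono_Suc_iff)
    show "incseq (\<lambda>j. snd (a j))" using a(2) by (simp add: incseq_Suc_iff)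
  qed
qed

end

subsection \<open>Completeness\<close>

lemma borel_measurable_cnj [measurable (raw)]:
  "f \<in> borel_measurable M \<Longrightarrow> (\<lambda>x. cnj (f x)) \<in> borel_measurable M"
  by (rule borel_measurable_continuous_on) (intro continuous_intros)

context digit_sequence
begin

lemma integrable_law_bounded:
  fixes g :: "real^'d \<Rightarrow> complex"
  assumes "g \<in> borel_measurable borel" "\<And>x. norm (g x) \<le> C"
  shows "integrable law g"
  using assms by (intro law.integrable_const_bound[where B = C]) (auto simp: measurable_cong_sets[OF sets_law refl])

lemma integral_expo_mult_cnj: "(LINT x|law. expo a x * cnj (expo b x)) = ft (a - b)"
  by (simp add: ft_def expo_diff_mult_cnj)

lemma cnj_ft: "cnj (ft a) = ft (- a)"
  using Bochner_Integration.integral_cnj[of law "expo a"] by (simp add: ft_def cnj_expo)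

text \<open>Expand the square: orthogonality reduces the double sum to its diagonal, and both mixed
  sums equal the same sum of squares.\<close>

lemma bessel_identity:
  assumes fin: "finite \<Lambda>" and orth: "\<And>l l'. l \<in> \<Lambda> \<Longrightarrow> l' \<in> \<Lambda> \<Longrightarrow> l \<noteq> l' \<Longrightarrow> ft (l - l') = 0"
  shows "(LINT x|law. (norm (expo a x - (\<Sum>l\<in>\<Lambda>. ft (a - l) * expo l x)))\<^sup>2) = 1 - (\<Sum>l\<in>\<Lambda>. (norm (ft (a - l)))\<^sup>2)"
proof -
  let ?c = "\<lambda>l. ft (a - l)"
  let ?h = "\<lambda>x. \<Sum>l\<in>\<Lambda>. ?c l * expo l x"
  have i: "integrable law (\<lambda>x. c * (expo u x * cnj (expo v x)))" for c u v
    by (rule integrable_law_bounded[where C = "norm c"]) (auto simp: norm_mult)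
  have i1: "integrable law (\<lambda>x. expo u x * cnj (expo v x))" for u v
    using i[of 1 u v] by simp
  have eq: "complex_of_real ((norm (expo a x - ?h x))\<^sup>2) = expo a x * cnj (expo a x)
      - (\<Sum>l\<in>\<Lambda>. cnj (?c l) * (expo a x * cnj (expo l x)))
      - (\<Sum>l\<in>\<Lambda>. ?c l * (expo l x * cnj (expo a x)))
      + (\<Sum>l\<in>\<Lambda>. \<Sum>l'\<in>\<Lambda>. ?c l * cnj (?c l') * (expo l x * cnj (expo l' x)))" for x
  proof -
    have "(\<Sum>l\<in>\<Lambda>. \<Sum>l'\<in>\<Lambda>. ?c l * cnj (?c l') * (expo l x * cnj (expo l' x))) = ?h x * cnj (?h x)"
      by (simp add: sum_product mult_ac)
    moreover have "(\<Sum>l\<in>\<Lambda>. cnj (?c l) * (expo a x * cnj (expo l x))) = expo a x * cnj (?h x)"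
      by (simp add: sum_distrib_left mult_ac)
    moreover have "(\<Sum>l\<in>\<Lambda>. ?c l * (expo l x * cnj (expo a x))) = ?h x * cnj (expo a x)"
      by (simp add: sum_distrib_left mult_ac)
    ultimately show ?thesis
      by (simp only: complex_norm_square complex_cnj_diff) (simp add: algebra_simps)
  qed
  have "complex_of_real (LINT x|law. (norm (expo a x - ?h x))\<^sup>2)
      = (LINT x|law. complex_of_real ((norm (expo a x - ?h x))\<^sup>2))"
    by (rule integral_complex_of_real[symmetric])
  also have "\<dots> = 1 - (\<Sum>l\<in>\<Lambda>. cnj (?c l) * ft (a - l)) - (\<Sum>l\<in>\<Lambda>. ?c l * ft (l - a))
      + (\<Sum>l\<in>\<Lambda>. \<Sum>l'\<in>\<Lambda>. ?c l * cnj (?c l') * ft (l - l'))"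
    unfolding eq using i i1
    by (simp add: integral_expo_mult_cnj)
  also have "(\<Sum>l\<in>\<Lambda>. \<Sum>l'\<in>\<Lambda>. ?c l * cnj (?c l') * ft (l - l')) = (\<Sum>l\<in>\<Lambda>. ?c l * cnj (?c l))"
  proof (rule sum.cong[OF refl])
    fix l assume l: "l \<in> \<Lambda>"
    have "(\<Sum>l'\<in>\<Lambda>. ?c l * cnj (?c l') * ft (l - l')) = (\<Sum>l'\<in>\<Lambda>. if l' = l then ?c l * cnj (?c l) else 0)"
      using l orth by (intro sum.cong) auto
    then show "(\<Sum>l'\<in>\<Lambda>. ?c l * cnj (?c l') * ft (l - l')) = ?c l * cnj (?c l)"
      using l fin by simp
  qed
  also have "(\<Sum>l\<in>\<Lambda>. ?c l * ft (l - a)) = (\<Sum>l\<in>\<Lambda>. ?c l * cnj (?c l))"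
    by (simp add: cnj_ft)
  also have "1 - (\<Sum>l\<in>\<Lambda>. cnj (?c l) * ft (a - l)) - (\<Sum>l\<in>\<Lambda>. ?c l * cnj (?c l)) + (\<Sum>l\<in>\<Lambda>. ?c l * cnj (?c l))
      = complex_of_real (1 - (\<Sum>l\<in>\<Lambda>. (norm (?c l))\<^sup>2))"
    by (simp add: complex_norm_square mult.commute del: of_real_power)
  finally show ?thesis unfolding of_real_eq_iff .
qed

context
  fixes e \<delta> :: real and N :: "nat \<Rightarrow> nat" and \<Lambda> :: "nat \<Rightarrow> (real^'d) set"
  assumes good: "\<And>j. good_level e \<delta> (N j, \<Lambda> j)" and N: "strict_mono N" and inc: "incseq \<Lambda>"
    and pos: "0 < e" "0 < \<delta>"
begin

lemma level_spectrum: "fin_spectrum (partial_ft (N j)) (\<Lambda> j)"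
  using good[of j] by (simp add: good_level_def)

lemma level_finite: "finite (\<Lambda> j)"
  using level_spectrum by (simp add: fin_spectrum_def)

text \<open>A zero of the transform at level \<open>N j\<close> is a zero of \<open>ft\<close>,
  which contains it as a factor.\<close>

lemma level_orthogonal:
  assumes "l \<in> \<Lambda> j" "l' \<in> \<Lambda> j" "l \<noteq> l'"
  shows "ft (l - l') = 0"
  using fin_spectrum_zero[OF level_spectrum partial_ft_zero assms] ft_shift[of "l - l'" "N j"] by simp

lemma level_bessel:
  "(LINT x|law. (norm (expo a x - (\<Sum>l\<in>\<Lambda> j. ft (a - l) * expo l x)))\<^sup>2) = 1 - (\<Sum>l\<in>\<Lambda> j. (norm (ft (a - l)))\<^sup>2)"
  by (rule bessel_identity[OF level_finite]) (rule level_orthogonal)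

text \<open>The finite-level sum, which is 1, is split at \<open>\<Lambda> K\<close>. The inner part
  tends to \<open>Q K\<close> as j grows, and goodness bounds the outer part by
  \<open>(Q j - Q K) / e\<^sup>2\<close>, hence by \<open>t\<close>.\<close>

lemma parseval_limit:
  assumes "0 < t"
  shows "\<exists>K. 1 - t \<le> (\<Sum>l\<in>\<Lambda> K. (norm (ft (\<xi> + l)))\<^sup>2)"
proof -
  define Q where "Q j = (\<Sum>l\<in>\<Lambda> j. (norm (ft (\<xi> + l)))\<^sup>2)" for j
  have mono: "incseq Q"
  proof (rule incseq_SucI)
    show "Q j \<le> Q (Suc j)" for j
      unfolding Q_def using incseq_SucD[OF inc] level_finite by (intro sum_mono2) auto
  qed
  have "Q j \<le> 1" for j
  proof -
    \<comment> \<open>Bessel's inequality, taken at \<open>- \<xi>\<close> because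
      \<open>ft (- \<xi> - l)\<close> is the conjugate of \<open>ft (\<xi> + l)\<close>.\<close>
    have "0 \<le> 1 - (\<Sum>l\<in>\<Lambda> j. (norm (ft (- \<xi> - l)))\<^sup>2)"
      unfolding level_bessel[symmetric] by (rule Bochner_Integration.integral_nonneg) simp
    moreover have "norm (ft (- \<xi> - l)) = norm (ft (\<xi> + l))" for l
      using cnj_ft[of "\<xi> + l"] complex_mod_cnj[of "ft (\<xi> + l)"] by simp
    ultimately show ?thesis by (simp add: Q_def)
  qed
  then obtain q where q: "Q \<longlonglongrightarrow> q" "\<And>j. Q j \<le> q"
    using incseq_convergent[OF mono] by auto
  \<comment> \<open>\<open>K\<close> is chosen so that \<open>Q\<close> grows by less than
    \<open>t * e\<^sup>2\<close> afterwards; the loss of the factor \<open>e\<^sup>2\<close> turns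
    this into \<open>t\<close>.\<close>
  have "\<forall>\<^sub>F K in sequentially. q - t * e\<^sup>2 < Q K"
    using q(1) assms pos by (intro order_tendstoD) auto
  then obtain K where K: "q - t * e\<^sup>2 < Q K" by (auto simp: eventually_sequentially)
  have "(\<lambda>j. \<Sum>l\<in>\<Lambda> K. (norm (partial_ft (N j) (\<xi> + l)))\<^sup>2) \<longlonglongrightarrow> Q K"
    unfolding Q_def
    using LIMSEQ_subseq_LIMSEQ[OF partial_ft_tendsto N] by (intro tendsto_intros) (simp add: o_def)
  then have lim: "(\<lambda>j. (\<Sum>l\<in>\<Lambda> K. (norm (partial_ft (N j) (\<xi> + l)))\<^sup>2) + t) \<longlonglongrightarrow> Q K + t"
    by (intro tendsto_intros)
  have "(\<lambda>j. norm \<xi> * (1 / 2) ^ j) \<longlonglongrightarrow> 0"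
    by (intro tendsto_mult_right_zero LIMSEQ_realpow_zero) auto
  then have "\<forall>\<^sub>F j in sequentially. norm \<xi> * (1 / 2) ^ j < \<delta> / 2"
    using pos by (intro order_tendstoD) auto
  then have "\<forall>\<^sub>F j in sequentially. 1 \<le> (\<Sum>l\<in>\<Lambda> K. (norm (partial_ft (N j) (\<xi> + l)))\<^sup>2) + t"
    using eventually_ge_at_top[of K]
  proof eventually_elim
    case (elim j)
    have sub: "\<Lambda> K \<subseteq> \<Lambda> j" using inc elim(2) by (rule incseqD)
    have "norm (vdiv \<xi> (p (N j))) \<le> norm \<xi> * (1 / 2) ^ N j"
      using norm_vdiv_le[of \<xi> "N j"] by (simp add: power_divide)
    also have "\<dots> \<le> norm \<xi> * (1 / 2) ^ j"
      using seq_suble[OF N, of j] by (intro mult_left_mono power_decreasing) auto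
    finally have small: "norm (vdiv \<xi> (p (N j))) < \<delta> / 2" using elim(1) by linarith
    have le: "(norm (partial_ft (N j) (\<xi> + l)))\<^sup>2 \<le> (norm (ft (\<xi> + l)))\<^sup>2 / e\<^sup>2" if "l \<in> \<Lambda> j" for l
    proof -
      \<comment> \<open>Dividing by \<open>p (N j)\<close> separates \<open>l\<close> from the small
        vector \<open>vdiv \<xi> (p (N j))\<close>, which plays the role of \<open>y\<close> in
        \<open>good_level\<close>.\<close>
      have "e \<le> norm (digit_sequence.ft (\<lambda>i. s (N j + i)) (vdiv (\<xi> + l) (p (N j))))"
        using good[of j] that small by (auto simp: good_level_def vdiv_add add.commute)
      then have "norm (partial_ft (N j) (\<xi> + l)) * e \<le> norm (ft (\<xi> + l))"
        unfolding ft_shift[of "\<xi> + l" "N j"] norm_mult by (intro mult_left_mono) auto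
      then have "(norm (partial_ft (N j) (\<xi> + l)) * e)\<^sup>2 \<le> (norm (ft (\<xi> + l)))\<^sup>2"
        using pos by (intro power_mono) auto
      then show ?thesis using pos by (simp add: field_simps)
    qed
    have "1 = (\<Sum>l\<in>\<Lambda> j. (norm (partial_ft (N j) (\<xi> + l)))\<^sup>2)"
      using level_spectrum by (simp add: fin_spectrum_def)
    also have "\<dots> = (\<Sum>l\<in>\<Lambda> K. (norm (partial_ft (N j) (\<xi> + l)))\<^sup>2)
        + (\<Sum>l\<in>\<Lambda> j - \<Lambda> K. (norm (partial_ft (N j) (\<xi> + l)))\<^sup>2)"
      using sub level_finite by (simp add: sum.subset_diff add.commute)
    also have "(\<Sum>l\<in>\<Lambda> j - \<Lambda> K. (norm (partial_ft (N j) (\<xi> + l)))\<^sup>2)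
        \<le> (\<Sum>l\<in>\<Lambda> j - \<Lambda> K. (norm (ft (\<xi> + l)))\<^sup>2 / e\<^sup>2)"
      using le by (intro sum_mono) auto
    also have "\<dots> = (Q j - Q K) / e\<^sup>2"
      using sub level_finite by (simp add: Q_def sum_diff sum_divide_distrib diff_divide_distrib)
    also have "\<dots> \<le> t"
      using K q(2)[of j] pos by (simp add: field_simps)
    finally show ?case by simp
  qed
  then have "1 \<le> Q K + t"
    using lim by (intro tendsto_lowerbound[OF lim]) auto
  then show ?thesis unfolding Q_def by (intro exI[of _ K]) simp
qed

text \<open>Two points always lie in a common level, whence orthonormality. For completeness,
  \<open>parseval_limit\<close> makes every exponential an L2-limit of combinations from the levels,
  so \<open>f\<close> has only zero coefficients and uniqueness on the cube applies.\<close>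

lemma spectrum_of_levels:
  assumes card: "\<And>k. card (snd (s k)) \<le> C"
  shows "spectrum_of law (\<Union>j. \<Lambda> j)"
  unfolding spectrum_of_def
proof (intro conjI ballI allI impI)
  show "countable (\<Union>j. \<Lambda> j)" using level_finite by (simp add: countable_finite)
  fix l l' assume "l \<in> (\<Union>j. \<Lambda> j)" "l' \<in> (\<Union>j. \<Lambda> j)"
  then obtain i j where "l \<in> \<Lambda> i" "l' \<in> \<Lambda> j" by blast
  then have "l \<in> \<Lambda> (max i j)" "l' \<in> \<Lambda> (max i j)"
    using incseqD[OF inc, of i "max i j"] incseqD[OF inc, of j "max i j"] by auto
  then show "(LINT x|law. expo l x * cnj (expo l' x)) = (if l = l' then 1 else 0)"
    using level_orthogonal by (simp add: integral_expo_mult_cnj)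
next
  fix f assume "square_integrable law f \<and> (\<forall>lam\<in>\<Union> (range \<Lambda>). (LINT x|law. f x * cnj (expo lam x)) = 0)"
  then have [measurable]: "f \<in> borel_measurable law" and f2: "integrable law (\<lambda>x. (norm (f x))\<^sup>2)"
    and perp: "\<And>l j. l \<in> \<Lambda> j \<Longrightarrow> (LINT x|law. f x * cnj (expo l x)) = 0"
    by (auto simp: square_integrable_def)
  have f1: "integrable law f"
  proof (rule Bochner_Integration.integrable_bound)
    show "integrable law (\<lambda>x. (norm (f x))\<^sup>2 + 1)" using f2 by simp
    have "norm (f x) \<le> (norm (f x))\<^sup>2 + 1" for x
      using sum_squares_bound[of "norm (f x)" 1] norm_ge_zero[of "f x"] by (simp del: norm_ge_zero)
    then show "AE x in law. norm (f x) \<le> norm ((norm (f x))\<^sup>2 + 1)" by (auto intro!: AE_I2)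
  qed simp
  have "(LINT x|law. f x * expo \<xi> x) = 0" for \<xi>
  proof -
    define I where "I = (LINT x|law. f x * expo \<xi> x)"
    define F where "F = (LINT x|law. (norm (f x))\<^sup>2)"
    have bound: "norm I \<le> t * (F + 1)" if t: "0 < t" for t
    proof -
      obtain K where K: "1 - t\<^sup>2 \<le> (\<Sum>l\<in>\<Lambda> K. (norm (ft (\<xi> + l)))\<^sup>2)"
        using parseval_limit[of "t\<^sup>2" \<xi>] t by auto
      \<comment> \<open>Remainder of \<open>expo (- \<xi>)\<close> after projection to level
        \<open>K\<close>; \<open>f\<close> is orthogonal to the projection, so pairing it with
        \<open>g\<close> gives \<open>I\<close>.\<close>
      define g where "g x = expo (- \<xi>) x - (\<Sum>l\<in>\<Lambda> K. ft (- \<xi> - l) * expo l x)" for x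
      have gm [measurable]: "g \<in> borel_measurable borel" unfolding g_def by measurable
      have gb: "norm (g x) \<le> 1 + (\<Sum>l\<in>\<Lambda> K. norm (ft (- \<xi> - l)))" for x
      proof -
        have "norm (\<Sum>l\<in>\<Lambda> K. ft (- \<xi> - l) * expo l x) \<le> (\<Sum>l\<in>\<Lambda> K. norm (ft (- \<xi> - l)))"
          by (rule order_trans[OF norm_sum]) (simp add: norm_mult)
        then show ?thesis
          unfolding g_def using norm_triangle_ineq4[of "expo (- \<xi>) x"] by (smt (verit) norm_expo)
      qed
      have g2: "integrable law (\<lambda>x. (norm (g x))\<^sup>2)"
        using gb by (intro law.integrable_const_bound[where B = "(1 + (\<Sum>l\<in>\<Lambda> K. norm (ft (- \<xi> - l))))\<^sup>2"])
           (auto intro!: power_mono)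
      have fe: "integrable law (\<lambda>x. f x * (c * cnj (expo l x)))" for c l
        using integrable_mult_bounded[OF sets_law f1, of "\<lambda>x. c * cnj (expo l x)" "norm c"]
        by (simp add: norm_mult)
      have fg: "integrable law (\<lambda>x. f x * cnj (g x))"
        using gb by (intro integrable_mult_bounded[OF sets_law f1]) auto
      have "(LINT x|law. f x * cnj (g x))
          = (LINT x|law. f x * (1 * cnj (expo (- \<xi>) x)) - (\<Sum>l\<in>\<Lambda> K. f x * (cnj (ft (- \<xi> - l)) * cnj (expo l x))))"
        by (simp add: g_def algebra_simps sum_distrib_left)
      also have "\<dots> = (LINT x|law. f x * (1 * cnj (expo (- \<xi>) x)))
          - (\<Sum>l\<in>\<Lambda> K. LINT x|law. f x * (cnj (ft (- \<xi> - l)) * cnj (expo l x)))"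
        using fe fe[of 1 "- \<xi>"] by (subst Bochner_Integration.integral_diff) (auto simp: Bochner_Integration.integral_sum)
      also have "\<dots> = I"
      proof -
        have "(LINT x|law. f x * (c * cnj (expo l x))) = 0" if "l \<in> \<Lambda> K" for l c
        proof -
          have "(LINT x|law. f x * (c * cnj (expo l x))) = c * (LINT x|law. f x * cnj (expo l x))"
            by (subst integral_mult_right_zero[symmetric]) (simp add: mult_ac)
          then show ?thesis using perp[OF that] by simp
        qed
        then show ?thesis by (simp add: I_def cnj_expo)
      qed
      finally have "norm I \<le> (LINT x|law. norm (f x * cnj (g x)))"
        by (metis integral_norm_bound)
      \<comment> \<open>A weighted arithmetic-geometric inequality in place of Cauchy-Schwarz; as
        the squared norm of \<open>g\<close> is at most \<open>t\<^sup>2\<close>, it gives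
        \<open>t * F + t\<close>.\<close>
      also have "\<dots> \<le> (LINT x|law. t * (norm (f x))\<^sup>2 + (norm (g x))\<^sup>2 / t)"
      proof (rule integral_mono)
        fix x
        have "2 * (t * (norm (f x) * norm (g x))) \<le> (t * norm (f x))\<^sup>2 + (norm (g x))\<^sup>2"
          using sum_squares_bound[of "t * norm (f x)" "norm (g x)"] by (simp add: mult.assoc)
        moreover have "0 \<le> t * (norm (f x) * norm (g x))" using t by simp
        moreover have "t * (t * (norm (f x))\<^sup>2 + (norm (g x))\<^sup>2 / t) = (t * norm (f x))\<^sup>2 + (norm (g x))\<^sup>2"
          using t by (simp add: field_simps power2_eq_square)
        ultimately have "t * (norm (f x) * norm (g x)) \<le> t * (t * (norm (f x))\<^sup>2 + (norm (g x))\<^sup>2 / t)"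
          by linarith
        then show "norm (f x * cnj (g x)) \<le> t * (norm (f x))\<^sup>2 + (norm (g x))\<^sup>2 / t"
          using t by (simp add: norm_mult)
      qed (use fg f2 g2 in auto)
      also have "\<dots> = t * F + (LINT x|law. (norm (g x))\<^sup>2) / t"
        using f2 g2 by (simp add: F_def)
      also have "(LINT x|law. (norm (g x))\<^sup>2) \<le> t\<^sup>2"
      proof -
        have "norm (ft (- \<xi> - l)) = norm (ft (\<xi> + l))" for l
          using cnj_ft[of "\<xi> + l"] complex_mod_cnj[of "ft (\<xi> + l)"] by simp
        then show ?thesis
          using level_bessel[of "- \<xi>" K] K by (simp add: g_def)
      qed
      finally show ?thesis using t by (simp add: field_simps power2_eq_square)
    qed
    have "norm I \<le> 0"
    proof (rule field_le_epsilon)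
      fix r :: real assume "0 < r"
      have "0 \<le> F" by (simp add: F_def)
      then show "norm I \<le> 0 + r"
        using bound[of "r / (F + 1)"] \<open>0 < r\<close> by simp
    qed
    then show ?thesis by (simp add: I_def)
  qed
  then show "AE x in law. f x = 0"
    by (intro law_fourier_uniqueness[OF card f1])
qed

end

end

section \<open>Reduction to a finite alphabet and conclusion\<close>

lemma diag_entry_le_onorm:
  fixes m :: "'d::finite \<Rightarrow> int"
  shows "real_of_int (m i) \<le> onorm (\<lambda>x. diag_mat m *v x)"
proof -
  have "norm (diag_mat m *v axis i 1) \<le> onorm (\<lambda>x. diag_mat m *v x) * norm (axis i 1 :: real^'d)"
    by (rule onorm) (rule matrix_vector_mul_bounded_linear)
  moreover have "(diag_mat m *v axis i 1) $ i = real_of_int (m i)"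
    by (simp add: diag_mat_eq diag_vmult axis_def)
  ultimately show ?thesis
    using component_le_norm_cart[of "diag_mat m *v axis i 1" i] by simp
qed

lemma finite_bounded_D:
  "finite {(m, B) | (m :: 'd::finite \<Rightarrow> int) B. in_D m B \<and> (\<forall>i. real_of_int (m i) \<le> K)}"
proof (rule finite_subset)
  let ?M = "UNIV \<rightarrow>\<^sub>E {0..\<lfloor>K\<rfloor>} :: ('d \<Rightarrow> int) set"
  let ?X = "{x :: real^'d. \<forall>i. x $ i \<in> \<int> \<and> 0 \<le> x $ i \<and> x $ i \<le> K}"
  show "{(m, B) | m B. in_D m B \<and> (\<forall>i. real_of_int (m i) \<le> K)} \<subseteq> ?M \<times> Pow ?X"
  proof
    fix a :: "('d \<Rightarrow> int) \<times> (real^'d) set"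
    assume "a \<in> {(m, B) | m B. in_D m B \<and> (\<forall>i. real_of_int (m i) \<le> K)}"
    then obtain m B where a: "a = (m, B)" and D: "in_D m B" and K: "\<forall>i. real_of_int (m i) \<le> K"
      by blast
    have "m i \<in> {0..\<lfloor>K\<rfloor>}" for i
    proof -
      have "2 \<le> m i" using D by (simp add: in_D_def)
      then show ?thesis using K by (simp add: le_floor_iff)
    qed
    moreover have "b $ i \<in> \<int> \<and> 0 \<le> b $ i \<and> b $ i \<le> K" if b: "b \<in> B" for b i
    proof -
      have "b $ i \<in> \<int> \<and> 0 \<le> b $ i \<and> b $ i \<le> real_of_int (m i) - 1"
        using D b by (auto simp: in_D_def)
      then show ?thesis using K[rule_format, of i] by linarith
    qed
    ultimately show "a \<in> ?M \<times> Pow ?X" by (auto simp: a PiE_iff)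
  qed
  show "finite (?M \<times> Pow ?X)"
    by (intro finite_cartesian_product finite_PiE finite_bounded_lattice finite_Pow_iff[THEN iffD2]) auto
qed

theorem theorem1p7:
  fixes m :: "nat \<Rightarrow> 'd::finite \<Rightarrow> int"
    and B :: "nat \<Rightarrow> (real^'d) set"
    and \<mu> :: "(real^'d) measure"
  assumes D: "\<forall>n\<ge>1. in_D (m n) (B n)"
    and adm: "\<forall>n\<ge>1. admissible (diag_mat (m n)) (B n)"
    and bdd: "bdd_above {onorm (\<lambda>x. diag_mat (m n) *v x) | n. n \<ge> 1}"
    and prob: "prob_space \<mu>" and sets: "sets \<mu> = sets borel"
    and lim: "weak_conv (\<lambda>n. measure_pmf (fin_conv (\<lambda>k. diag_mat (m k)) B n)) \<mu>"
  shows "spectral \<mu> \<and> (\<exists>Lam. Lam \<subseteq> int_lattice \<and> spectrum_of \<mu> Lam)"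
proof -
  \<comment> \<open>The given sequences start at 1, so \<open>s 0\<close> is the first pair.\<close>
  define s where "s = (\<lambda>k. (m (Suc k), B (Suc k)))"
  interpret digit_sequence s
    by unfold_locales (use D in \<open>auto simp: in_D_seq_def s_def\<close>)
  obtain K where "\<And>n. n \<ge> 1 \<Longrightarrow> onorm (\<lambda>x. diag_mat (m n) *v x) \<le> K"
    using bdd by (auto simp: bdd_above_def)
  then have K: "real_of_int (m n i) \<le> K" if "n \<ge> 1" for n i
    using order_trans[OF diag_entry_le_onorm] that by blast
  \<comment> \<open>A finite alphabet containing all pairs, hence those of every tail: the constants
    \<open>e\<close> and \<open>\<delta>\<close> below serve all tails at once.\<close>
  define A where "A = {(m, B) | (m :: 'd \<Rightarrow> int) B. in_D m B \<and> (\<forall>i. real_of_int (m i) \<le> K)}"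
  have finA: "finite A" unfolding A_def by (rule finite_bounded_D)
  have DA: "\<forall>(m, B)\<in>A. in_D m B" by (auto simp: A_def)
  have sA: "s k \<in> A" for k using assms(1) K by (auto simp: A_def s_def)
  have card: "card (snd (s k)) \<le> Max ((\<lambda>a. card (snd a)) ` A)" for k
    using finA sA by (intro Max_ge) auto
  have adm': "admissible (diag_mat (fst (s k))) (snd (s k))" for k
    using adm by (simp add: s_def)
  obtain e \<delta> where pos: "0 < e" "0 < \<delta>"
    and equi: "\<And>s x. range s \<subseteq> A \<Longrightarrow> \<exists>k\<in>int_lattice. (x = 0 \<longrightarrow> k = 0) \<and>
      (\<forall>y. norm y < \<delta> \<longrightarrow> e \<le> norm (digit_sequence.ft s (x + k + y)))"
    using ft_equi_positive[OF finA DA] by blast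
  have "range (\<lambda>j. s (n + j)) \<subseteq> A" for n using sA by auto
  then obtain N \<Lambda> where good: "\<And>j. good_level e \<delta> (N j, \<Lambda> j)" and "strict_mono N" "incseq \<Lambda>"
    using ex_good_levels[OF adm' pos(2) equi] by blast
  then have spec: "spectrum_of law (\<Union>j. \<Lambda> j)"
    using pos card by (rule spectrum_of_levels)
  have "(\<Union>j. \<Lambda> j) \<subseteq> int_lattice"
    using good by (fastforce simp: good_level_def fin_spectrum_def)
  moreover have "\<mu> = law"
    using lim unfolding fin_conv_eq_fconv[OF s_def] by (rule weak_limit_eq_law[OF prob sets])
  ultimately show ?thesis using spec by (auto simp: spectral_def)
qed

end
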